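(* Let $(Z_n)_{n\ge 0}$ be a branching process in a stationary and ergodic random environment $\xi=(\xi_0,\xi_1,\dots)$, which is supercritical in the sense that $\mathbb{E}\log m_0\in(0,\infty)$. Let $W_n=Z_n/\Pi_n$ and $W=\lim_{n\to\infty}W_n$ a.s. Assume that $$\mathbb{E}\left[\frac{Z_1}{m_0}\left(\log^+\frac{Z_1}{m_0}\right)^{1+\alpha}\right]<\infty$$ for some $\alpha>0$. Then, as $n\to\infty$, $$W-W_n=o(n^{-\alpha})\quad\text{a.s.}$$ Moreover, if $\alpha\ge1$, the series $\sum_n (W-W_n)$ converges a.s.
   Context: Branching process in a random environment: $\xi=(\xi_0,\xi_1,\xi_2,\dots)$ is a stationary and ergodic sequence of random variables. Each realization of $\xi_n$ corresponds to a probability distribution $p(\xi_n)=\{p_i(\xi_n): i\in\mathbb{N}_0\}$ on $\mathbb{N}_0=\{0,1,2,\dots\}$ (so $p_i(\xi_n)\ge0$, $\sum_i p_i(\xi_n)=1$) with $\sum_i i\,p_i(\xi_n)\in(0,\infty)$. The process is defined by $Z_0=1$, $Z_{n+1}=\sum_{i=1}^{Z_n}X_{n,i}$ for $n\ge0$, where, conditionally on $\xi$, the random variables $X_{n,i}$ ($n\ge0$, $i\ge1$) are independent and each $X_{n,i}$ has distribution $p(\xi_n)$. $\mathbb{P}_\xi$ and $\mathbb{E}_\xi$ denote the conditional probability and expectation given $\xi$ (quenched law); $\mathbb{P}$ and $\mathbb{E}$ denote the total probability and expectation (annealed law). Notation: $m_n=\sum_{i\ge1} i\,p_i(\xi_n)$,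 $\Pi_0=1$, $\Pi_n=\prod_{i=0}^{n-1}m_i=\mathbb{E}_\xi Z_n$. The sequence $W_n=Z_n/\Pi_n$ is a nonnegative martingale under $\mathbb{P}_\xi$ with respect to $\mathcal{F}_n=\sigma(\xi_0,\xi_1,\dots;\,X_{k,i}, 0\le k\le n-1, i\ge1)$, and hence converges a.s. to a limit $W$. As usual $\log^+x=\max(\log x,0)$, with $\log^+0=0$. *)

theory Defs
  imports "HOL-Probability.Probability" "HOL-Library.Landau_Symbols"
begin

definition path_law :: "'a measure \<Rightarrow> 'e measure \<Rightarrow> (nat \<Rightarrow> 'a \<Rightarrow> 'e) \<Rightarrow> (nat \<Rightarrow> 'e) measure" where
  "path_law M E \<xi> = distr M (\<Pi>\<^sub>M n\<in>UNIV. E) (\<lambda>\<omega> n. \<xi> n \<omega>)"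

definition stationary_seq :: "'a measure \<Rightarrow> 'e measure \<Rightarrow> (nat \<Rightarrow> 'a \<Rightarrow> 'e) \<Rightarrow> bool" where
  "stationary_seq M E \<xi> \<longleftrightarrow> (\<forall>k. path_law M E (\<lambda>n. \<xi> (n + k)) = path_law M E \<xi>)"

text \<open>Ergodicity of the sequence: events of the path space that are invariant under the left
  shift have probability 0 or 1.\<close>
definition ergodic_seq :: "'a measure \<Rightarrow> 'e measure \<Rightarrow> (nat \<Rightarrow> 'a \<Rightarrow> 'e) \<Rightarrow> bool" where
  "ergodic_seq M E \<xi> \<longleftrightarrow>
     (\<forall>A \<in> sets (\<Pi>\<^sub>M n\<in>(UNIV :: nat set). E).
        (\<lambda>x n. x (Suc n)) -` A \<inter> space (\<Pi>\<^sub>M n\<in>(UNIV :: nat set). E) = A \<longrightarrow>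
        measure (path_law M E \<xi>) A \<in> {0, 1})"

definition env_algebra :: "'a measure \<Rightarrow> 'e measure \<Rightarrow> (nat \<Rightarrow> 'a \<Rightarrow> 'e) \<Rightarrow> 'a measure" where
  "env_algebra M E \<xi> = vimage_algebra (space M) (\<lambda>\<omega> n. \<xi> n \<omega>) (\<Pi>\<^sub>M n\<in>UNIV. E)"

text \<open>A version of the conditional probability of the event \<open>A\<close> given the sub-sigma-algebra
  \<open>F\<close> (unrelated to the elementary \<open>cond_prob\<close> of the library).\<close>
definition prob_given :: "'a measure \<Rightarrow> 'a measure \<Rightarrow> 'a set \<Rightarrow> 'a \<Rightarrow> real" where
  "prob_given M F A = real_cond_exp M F (indicator A)"

definition cond_indep_vars ::
  "'a measure \<Rightarrow> 'a measure \<Rightarrow> ('i \<Rightarrow> 'b measure) \<Rightarrow> ('i \<Rightarrow> 'a \<Rightarrow> 'b) \<Rightarrow> 'i set \<Rightarrow> bool" where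
  "cond_indep_vars M F N Y I \<longleftrightarrow>
     (\<forall>i\<in>I. Y i \<in> measurable M (N i)) \<and>
     (\<forall>J A. finite J \<and> J \<subseteq> I \<and> (\<forall>j\<in>J. A j \<in> sets (N j)) \<longrightarrow>
        (AE \<omega> in M. prob_given M F {\<omega> \<in> space M. \<forall>j\<in>J. Y j \<omega> \<in> A j} \<omega> =
           (\<Prod>j\<in>J. prob_given M F {\<omega> \<in> space M. Y j \<omega> \<in> A j} \<omega>)))"

definition offspring_mean :: "nat pmf \<Rightarrow> real" where
  "offspring_mean q = (\<Sum>i. real i * pmf q i)"

text \<open>The environment takes values in an arbitrary measurable space \<open>E\<close>, and \<open>p e\<close> is the
  offspring law attached to the state \<open>e\<close>. The variables \<open>X n i\<close> matter only for \<open>i \<ge> 1\<close>.\<close>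
locale branching_process_random_env = prob_space M
  for M :: "'a measure" +
  fixes E :: "'e measure"
    and \<xi> :: "nat \<Rightarrow> 'a \<Rightarrow> 'e"
    and p :: "'e \<Rightarrow> nat pmf"
    and X :: "nat \<Rightarrow> nat \<Rightarrow> 'a \<Rightarrow> nat"
  assumes env_measurable: "\<xi> n \<in> measurable M E"
    and env_stationary: "stationary_seq M E \<xi>"
    and env_ergodic: "ergodic_seq M E \<xi>"
    and offspring_measurable: "(\<lambda>e. pmf (p e) i) \<in> borel_measurable E"
    and offspring_mean_finite:
      "\<omega> \<in> space M \<Longrightarrow> summable (\<lambda>i. real i * pmf (p (\<xi> n \<omega>)) i)"
    and offspring_mean_pos: "\<omega> \<in> space M \<Longrightarrow> 0 < offspring_mean (p (\<xi> n \<omega>))"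
    and offspring_cond_indep:
      "cond_indep_vars M (env_algebra M E \<xi>) (\<lambda>_. count_space UNIV)
         (\<lambda>(n, i). X n i) (UNIV \<times> {1..})"
    and offspring_cond_distr:
      "1 \<le> i \<Longrightarrow>
         AE \<omega> in M. prob_given M (env_algebra M E \<xi>) {\<omega> \<in> space M. X n i \<omega> = k} \<omega>
           = pmf (p (\<xi> n \<omega>)) k"

primrec bp_Z :: "(nat \<Rightarrow> nat \<Rightarrow> 'a \<Rightarrow> nat) \<Rightarrow> nat \<Rightarrow> 'a \<Rightarrow> nat" where
  "bp_Z X 0 = (\<lambda>\<omega>. 1)"
| "bp_Z X (Suc n) = (\<lambda>\<omega>. \<Sum>i = 1..bp_Z X n \<omega>. X n i \<omega>)"

definition bp_m :: "(nat \<Rightarrow> 'a \<Rightarrow> 'e) \<Rightarrow> ('e \<Rightarrow> nat pmf) \<Rightarrow> nat \<Rightarrow> 'a \<Rightarrow> real" where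
  "bp_m \<xi> p n \<omega> = offspring_mean (p (\<xi> n \<omega>))"

definition bp_Pi :: "(nat \<Rightarrow> 'a \<Rightarrow> 'e) \<Rightarrow> ('e \<Rightarrow> nat pmf) \<Rightarrow> nat \<Rightarrow> 'a \<Rightarrow> real" where
  "bp_Pi \<xi> p n \<omega> = (\<Prod>i<n. bp_m \<xi> p i \<omega>)"

definition bp_W ::
  "(nat \<Rightarrow> 'a \<Rightarrow> 'e) \<Rightarrow> ('e \<Rightarrow> nat pmf) \<Rightarrow> (nat \<Rightarrow> nat \<Rightarrow> 'a \<Rightarrow> nat) \<Rightarrow> nat \<Rightarrow> 'a \<Rightarrow> real" where
  "bp_W \<xi> p X n \<omega> = real (bp_Z X n \<omega>) / bp_Pi \<xi> p n \<omega>"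

text \<open>Meaningful only at points where the sequence converges; elsewhere \<open>lim\<close> is unspecified.\<close>
definition bp_W_lim ::
  "(nat \<Rightarrow> 'a \<Rightarrow> 'e) \<Rightarrow> ('e \<Rightarrow> nat pmf) \<Rightarrow> (nat \<Rightarrow> nat \<Rightarrow> 'a \<Rightarrow> nat) \<Rightarrow> 'a \<Rightarrow> real" where
  "bp_W_lim \<xi> p X \<omega> = lim (\<lambda>n. bp_W \<xi> p X n \<omega>)"

definition log_plus :: "real \<Rightarrow> real" where
  "log_plus x = (if 0 < x then max (ln x) 0 else 0)"

end

theory Submission
  imports Defs "HOL-Real_Asymp.Real_Asymp"
begin

text \<open>
  The weighted increments \<open>n\<^sup>\<alpha> \<bar>W (n+1) - W n\<bar>\<close> turn out to be absolutely summable almost surely, so no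
  martingale convergence theorem is needed; both claims then follow by summing tails, respectively by
  Abel summation.

  Given the environment, \<open>W (n+1) - W n\<close> is \<open>1 / \<Pi> n\<close> times a sum of \<open>Z n\<close> independent centred copies of
  \<open>Y - 1\<close>, where \<open>Y = X / m\<close>. Truncating \<open>Y\<close> at level \<open>t\<close>, the truncated part has variance at most \<open>t\<close>, and
  since \<open>Z n\<close> has quenched mean \<open>\<Pi> n\<close> the quenched mean of \<open>\<bar>W (n+1) - W n\<bar>\<close> is at most
  \<open>sqrt (t / \<Pi> n) + 2 E[Y; Y > t]\<close>. Take \<open>t = exp (a n)\<close> with \<open>4 a = E ln m\<close>. A one-sided ergodic
  theorem gives \<open>\<Pi> n \<ge> C exp (2 a n)\<close>, so the first term is summable against \<open>n\<^sup>\<alpha>\<close>. By stationarity, the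
  annealed mean of \<open>\<Sum>n. n\<^sup>\<alpha> E[Y; Y > exp (a n)]\<close> is at most a constant times
  \<open>E[Y (log\<^sup>+ Y) powr (1 + \<alpha>)]\<close>.
\<close>

section \<open>Real sequences and series\<close>

text \<open>For \<open>n \<ge> 1\<close> the weight is at least 1, so the increments are absolutely
  summable and \<open>lim w - w n\<close> is the tail of their series. Inside that tail
  \<open>n powr \<alpha>\<close> may be replaced by the larger \<open>(k + n) powr \<alpha>\<close>,
  which bounds the weighted tail by a tail of the convergent series \<open>u\<close>. For
  \<open>\<alpha> \<ge> 1\<close> the weight also dominates \<open>n\<close>, and this is what
  summation by parts requires.\<close>

lemma
  fixes w :: "nat \<Rightarrow> real" and \<alpha> :: real
  assumes \<alpha>: "0 < \<alpha>" and sm: "summable (\<lambda>n. real n powr \<alpha> * \<bar>w (Suc n) - w n\<bar>)"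
  shows tails_smallo_if_weighted_increments_summable: "(\<lambda>n. lim w - w n) \<in> o(\<lambda>n. real n powr (- \<alpha>))"
    and tails_summable_if_weighted_increments_summable: "1 \<le> \<alpha> \<Longrightarrow> summable (\<lambda>n. lim w - w n)"
proof -
  define d where "d n = w (Suc n) - w n" for n
  define u where "u n = real n powr \<alpha> * \<bar>d n\<bar>" for n
  have su: "summable u" using sm by (simp add: u_def[abs_def] d_def)
  have u0: "0 \<le> u n" for n by (simp add: u_def)
  \<comment> \<open>The comparison starts at 1: since \<open>0 powr \<alpha> = 0\<close>, the
    weighted series carries no information about \<open>d 0\<close>.\<close>
  have sd: "summable (\<lambda>n. \<bar>d n\<bar>)"
  proof (rule summable_comparison_test'[OF su, of 1])
    fix n :: nat assume "1 \<le> n"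
    then have "1 \<le> real n powr \<alpha>" using \<alpha> by (simp add: ge_one_powr_ge_zero)
    then show "norm \<bar>d n\<bar> \<le> u n" by (simp add: u_def mult_le_cancel_right1)
  qed
  have sd': "summable d" using sd by (rule summable_rabs_cancel)
  have wn: "w n = w 0 + (\<Sum>k<n. d k)" for n by (simp add: d_def sum_lessThan_telescope)
  have "(\<lambda>n. w 0 + (\<Sum>k<n. d k)) \<longlonglongrightarrow> w 0 + suminf d"
    by (intro tendsto_intros summable_LIMSEQ sd')
  then have "w \<longlonglongrightarrow> w 0 + suminf d" by (simp only: wn[symmetric])
  then have L: "lim w = w 0 + suminf d" by (rule limI)
  have tail: "lim w - w n = (\<Sum>k. d (k + n))" for n
    using suminf_minus_initial_segment[OF sd', of n] L wn[of n] by simp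
  have bd: "real n powr \<alpha> * \<bar>lim w - w n\<bar> \<le> (\<Sum>k. u (k + n))" for n
  proof -
    have s1: "summable (\<lambda>k. \<bar>d (k + n)\<bar>)" and s2: "summable (\<lambda>k. u (k + n))"
      using sd su by (simp_all add: summable_iff_shift[of "\<lambda>k. \<bar>d k\<bar>"])
    have "\<bar>lim w - w n\<bar> \<le> (\<Sum>k. \<bar>d (k + n)\<bar>)" unfolding tail by (rule summable_rabs[OF s1])
    then have "real n powr \<alpha> * \<bar>lim w - w n\<bar> \<le> real n powr \<alpha> * (\<Sum>k. \<bar>d (k + n)\<bar>)"
      by (intro mult_left_mono) auto
    also have "\<dots> = (\<Sum>k. real n powr \<alpha> * \<bar>d (k + n)\<bar>)" by (rule suminf_mult[OF s1, symmetric])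
    also have "\<dots> \<le> (\<Sum>k. u (k + n))"
      unfolding u_def using \<alpha> s2
      by (intro suminf_le mult_right_mono powr_mono2 summable_mult s1) (auto simp: u_def)
    finally show ?thesis .
  qed
  have "(\<lambda>n. \<Sum>k. u (k + n)) \<longlonglongrightarrow> 0"
    using suminf_exist_split2[OF su] .
  then have t0: "(\<lambda>n. real n powr \<alpha> * (lim w - w n)) \<longlonglongrightarrow> 0"
  proof (rule Lim_null_comparison[rotated])
    show "\<forall>\<^sub>F n in sequentially. norm (real n powr \<alpha> * (lim w - w n)) \<le> (\<Sum>k. u (k + n))"
      using bd by (simp add: abs_mult)
  qed
  show "(\<lambda>n. lim w - w n) \<in> o(\<lambda>n. real n powr (- \<alpha>))"
  proof (rule smalloI_tendsto)
    show "(\<lambda>n. (lim w - w n) / real n powr (- \<alpha>)) \<longlonglongrightarrow> 0"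
      using t0 by (simp add: powr_minus divide_inverse mult.commute)
    show "\<forall>\<^sub>F n in sequentially. real n powr (- \<alpha>) \<noteq> 0"
      using eventually_gt_at_top[of 0] by eventually_elim auto
  qed
  assume \<alpha>1: "1 \<le> \<alpha>"
  have le: "real n \<le> real n powr \<alpha>" for n
    using powr_mono[OF \<alpha>1, of "real n"] by (cases "n = 0") auto
  \<comment> \<open>The increment \<open>d k\<close> with \<open>k < N\<close> occurs in the tails
    from \<open>0\<close> to \<open>k\<close>, that is \<open>Suc k\<close> times; what lies beyond
    \<open>N\<close> occurs in all \<open>N\<close> tails.\<close>
  have abel: "(\<Sum>n<N. lim w - w n) = real N * (lim w - w N) + (\<Sum>n<N. real (Suc n) * d n)" for N
    by (induction N) (simp_all add: d_def algebra_simps)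
  have "(\<lambda>N. real N * (lim w - w N)) \<longlonglongrightarrow> 0"
    using t0[THEN tendsto_norm_zero]
  proof (rule Lim_null_comparison[rotated])
    show "\<forall>\<^sub>F n in sequentially. norm (real n * (lim w - w n)) \<le> norm (real n powr \<alpha> * (lim w - w n))"
      using le by (intro always_eventually allI) (auto simp: abs_mult intro!: mult_right_mono)
  qed
  moreover have "summable (\<lambda>n. real (Suc n) * d n)"
  proof (rule summable_comparison_test'[OF summable_mult[OF su, of 2], of 1])
    fix n :: nat assume "1 \<le> n"
    then have "real (Suc n) \<le> 2 * real n powr \<alpha>" using le[of n] by simp
    then have "real (Suc n) * \<bar>d n\<bar> \<le> (2 * real n powr \<alpha>) * \<bar>d n\<bar>" by (intro mult_right_mono) auto
    then show "norm (real (Suc n) * d n) \<le> 2 * u n" by (simp add: u_def abs_mult)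
  qed
  ultimately have "(\<lambda>N. \<Sum>n<N. lim w - w n) \<longlonglongrightarrow> 0 + (\<Sum>n. real (Suc n) * d n)"
    unfolding abel by (intro tendsto_add summable_LIMSEQ)
  then show "summable (\<lambda>n. lim w - w n)" by (auto simp: summable_def sums_def)
qed

section \<open>Sums over exponential truncation levels\<close>

text \<open>The level \<open>exp (a * n)\<close> lies below \<open>y\<close> exactly when
  \<open>n < L = ln y / a\<close>. There are at most \<open>L\<close> such positive
  \<open>n\<close>, each of weight at most \<open>L powr \<alpha>\<close>; this produces the
  exponent \<open>1 + \<alpha>\<close>. For \<open>y \<le> 1\<close> no level lies below
  \<open>y\<close>.\<close>

lemma suminf_powr_indicator_exp_le:
  fixes a \<alpha> y :: real
  assumes a: "0 < a" and \<alpha>: "0 < \<alpha>"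
  shows "(\<Sum>n. ennreal (real n powr \<alpha> * indicator {y. exp (a * real n) < y} y))
    \<le> ennreal ((log_plus y / a) powr (1 + \<alpha>))"
proof (cases "1 < y")
  case True
  define L where "L = log_plus y / a"
  have L: "0 < L" using True a by (simp add: L_def log_plus_def)
  have ly: "log_plus y = ln y" using True by (simp add: log_plus_def)
  have iff: "exp (a * real n) < y \<longleftrightarrow> real n < L" for n
  proof -
    have "exp (a * real n) < y \<longleftrightarrow> a * real n < ln y"
      using True by (metis exp_less_cancel_iff exp_ln less_trans zero_less_one)
    then show ?thesis using a by (simp add: L_def ly field_simps)
  qed
  \<comment> \<open>Index \<open>0\<close> has weight \<open>0 powr \<alpha> = 0\<close>; leaving it
    out keeps the number of indices at most \<open>L\<close>.\<close>
  let ?S = "{1..nat \<lfloor>L\<rfloor>}"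
  have zero: "real n powr \<alpha> * indicator {y. exp (a * real n) < y} y = 0" if "n \<notin> ?S" for n
  proof (cases "n = 0")
    case False
    then have "\<not> real n < L" using that by (auto simp: not_le nat_less_iff) linarith
    then show ?thesis by (simp add: iff)
  qed simp
  have "(\<Sum>n. ennreal (real n powr \<alpha> * indicator {y. exp (a * real n) < y} y)) =
      (\<Sum>n\<in>?S. ennreal (real n powr \<alpha> * indicator {y. exp (a * real n) < y} y))"
  proof (rule suminf_finite)
    fix n assume "n \<notin> ?S"
    then show "ennreal (real n powr \<alpha> * indicator {y. exp (a * real n) < y} y) = 0"
      by (subst zero) simp_all
  qed simp
  also have "\<dots> \<le> (\<Sum>n\<in>?S. ennreal (L powr \<alpha>))"
    using \<alpha> L by (intro sum_mono ennreal_leI) (auto simp: iff indicator_def intro!: powr_mono2)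
  also have "\<dots> = ennreal (real (nat \<lfloor>L\<rfloor>) * L powr \<alpha>)"
    by (simp add: ennreal_of_nat_eq_real_of_nat ennreal_mult'')
  also have "\<dots> \<le> ennreal (L * L powr \<alpha>)"
    using L by (intro ennreal_leI mult_right_mono) auto
  also have "L * L powr \<alpha> = L powr (1 + \<alpha>)" using L by (simp add: powr_add)
  finally show ?thesis by (simp add: L_def)
next
  case False
  then have "\<not> exp (a * real n) < y" for n
    using a one_le_exp_iff[of "a * real n"] by (auto simp: not_less intro: order_trans[of y 1])
  then show ?thesis by simp
qed

lemma summable_powr_exp:
  fixes a \<alpha> :: real
  assumes "0 < a"
  shows "summable (\<lambda>n. real n powr \<alpha> * exp (- a * real n))"
proof (rule summable_comparison_test_bigo)
  show "summable (\<lambda>n. norm (real n powr -2))" by (simp add: summable_real_powr_iff)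
  show "(\<lambda>n. real n powr \<alpha> * exp (- a * real n)) \<in> O(\<lambda>n. real n powr -2)"
    using assms by real_asymp
qed

section \<open>A one-sided ergodic theorem\<close>

text \<open>The minimum of the Birkhoff sums \<open>\<Sum>i<k. f ((T ^^ i) x)\<close> over \<open>k \<le> n\<close>, in the recursive form
  that makes Garsia's argument immediate: \<open>f x \<le> ergodic_min T f n x - ergodic_min T f n (T x)\<close>
  wherever \<open>ergodic_min T f n x < 0\<close>.\<close>

fun ergodic_min :: "('a \<Rightarrow> 'a) \<Rightarrow> ('a \<Rightarrow> real) \<Rightarrow> nat \<Rightarrow> 'a \<Rightarrow> real" where
  "ergodic_min T f 0 x = 0"
| "ergodic_min T f (Suc n) x = min 0 (f x + ergodic_min T f n (T x))"

text \<open>It serves to detect negativity: one negative Birkhoff sum of length \<open>k\<close>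
  forces \<open>ergodic_min T f n x < 0\<close> for every \<open>n \<ge> k\<close>.\<close>

lemma ergodic_min_le_sum:
  "k \<le> n \<Longrightarrow> ergodic_min T f n x \<le> (\<Sum>i<k. f ((T ^^ i) x))"
proof (induction n arbitrary: k x)
  case (Suc n)
  show ?case
  proof (cases k)
    case (Suc k')
    then have "ergodic_min T f n (T x) \<le> (\<Sum>i<k'. f ((T ^^ i) (T x)))"
      using Suc.IH[of k' "T x"] Suc.prems by simp
    also have "f x + (\<Sum>i<k'. f ((T ^^ i) (T x))) = (\<Sum>i<k. f ((T ^^ i) x))"
      unfolding Suc sum.lessThan_Suc_shift by (simp add: funpow_swap1)
    finally show ?thesis by simp
  qed simp
qed simp

lemma ergodic_min_decreasing: "ergodic_min T f (Suc n) x \<le> ergodic_min T f n x"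
proof (induction n arbitrary: x)
  case (Suc n)
  show ?case using Suc[of "T x"] by simp
qed simp

text \<open>Garsia's argument. Where the minimum is negative, unfolding one step and monotonicity in
  \<open>n\<close> bound \<open>f x\<close> by \<open>?m n x - ?m n (T x)\<close>; elsewhere this
  difference is nonnegative because \<open>?m n x = 0\<close>. Its integral vanishes by invariance
  of the measure.\<close>

lemma (in prob_space) maximal_ergodic_inequality:
  fixes f :: "'a \<Rightarrow> real"
  assumes T[measurable]: "T \<in> measurable M M" and pres: "distr M M T = M"
    and f: "integrable M f"
  shows "(\<integral>x. f x * indicator {x. ergodic_min T f n x < 0} x \<partial>M) \<le> 0"
proof -
  let ?m = "ergodic_min T f"
  have [measurable]: "f \<in> borel_measurable M" using f by simp
  \<comment> \<open>Both claims go through one induction: \<open>?m (Suc n)\<close> contains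
    \<open>?m n\<close> composed with \<open>T\<close>, and invariance of the measure passes
    integrability on to the composition.\<close>
  have im: "integrable M (?m n) \<and> integrable M (\<lambda>x. ?m n (T x))" for n
  proof (induction n)
    case (Suc n)
    have 1: "integrable M (?m (Suc n))" unfolding ergodic_min.simps using Suc f by simp
    then have "integrable (distr M M T) (?m (Suc n))" by (simp add: pres)
    then show ?case using 1 integrable_distr[OF T] by blast
  qed simp
  have [measurable]: "?m n \<in> borel_measurable M" for n using im by (auto intro: borel_measurable_integrable)
  have [measurable]: "(\<lambda>x. f x * indicator {x. ?m n x < 0} x) \<in> borel_measurable M" by measurable
  have "(\<integral>x. f x * indicator {x. ?m n x < 0} x \<partial>M) \<le> (\<integral>x. ?m n x - ?m n (T x) \<partial>M)"
  proof (rule integral_mono)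
    show "integrable M (\<lambda>x. f x * indicator {x. ?m n x < 0} x)"
      by (rule Bochner_Integration.integrable_bound[OF f]) (auto simp: indicator_def)
    show "integrable M (\<lambda>x. ?m n x - ?m n (T x))" using im by auto
    fix x
    have nonpos: "?m k y \<le> 0" for k y by (cases k) auto
    show "f x * indicator {x. ?m n x < 0} x \<le> ?m n x - ?m n (T x)"
    proof (cases "?m n x < 0")
      case True
      then obtain k where k: "n = Suc k" by (cases n) auto
      have "?m n (T x) \<le> ?m k (T x)" unfolding k by (rule ergodic_min_decreasing)
      then show ?thesis using True by (simp add: k)
    next
      case False
      then show ?thesis using nonpos[of n "T x"] by simp
    qed
  qed
  also have "\<dots> = (\<integral>x. ?m n x \<partial>M) - (\<integral>x. ?m n x \<partial>distr M M T)"
    using im by (simp add: integral_distr)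
  also have "\<dots> = 0" by (simp add: pres)
  finally show ?thesis .
qed

text \<open>The event \<open>A\<close> that the Birkhoff sums are unbounded below is invariant,
  hence trivial. If it had probability 1, the sets \<open>{x. ?m n x < 0}\<close> would increase to
  a set of full measure, and dominated convergence in the maximal inequality would give
  \<open>expectation f \<le> 0\<close>.\<close>

lemma (in prob_space) AE_ergodic_sums_bounded_below:
  fixes f :: "'a \<Rightarrow> real"
  assumes T[measurable]: "T \<in> measurable M M" and pres: "distr M M T = M"
    and erg: "\<And>A. A \<in> sets M \<Longrightarrow> T -` A \<inter> space M = A \<Longrightarrow> prob A \<in> {0, 1}"
    and f: "integrable M f" and pos: "0 < expectation f"
  shows "AE x in M. \<exists>C. \<forall>n. C \<le> (\<Sum>i<n. f ((T ^^ i) x))"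
proof -
  let ?S = "\<lambda>n x. \<Sum>i<n. f ((T ^^ i) x)" and ?m = "ergodic_min T f"
  define A where "A = {x \<in> space M. \<forall>c::nat. \<exists>n. ?S n x < - real c}"
  have [measurable]: "f \<in> borel_measurable M" using f by simp
  have [measurable]: "(T ^^ i) \<in> measurable M M" for i by (induction i) auto
  have A[measurable]: "A \<in> sets M" unfolding A_def by measurable
  \<comment> \<open>The sums at \<open>x\<close> and at \<open>T x\<close> differ by the finite
    number \<open>f x\<close> and one index, so both directions of invariance only shift the
    threshold by a natural number \<open>b\<close>.\<close>
  have step: "?S (Suc n) x = f x + ?S n (T x)" for n x
    unfolding sum.lessThan_Suc_shift by (simp add: funpow_swap1)
  have Tsp: "T x \<in> space M" if "x \<in> space M" for x using measurable_space[OF T that] .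
  have "T -` A \<inter> space M = A"
  proof (intro set_eqI iffI)
    fix x assume "x \<in> T -` A \<inter> space M"
    then have x: "x \<in> space M" and *: "\<And>c::nat. \<exists>n. ?S n (T x) < - real c" by (auto simp: A_def)
    have "\<exists>n. ?S n x < - real c" for c
    proof -
      obtain b :: nat where b: "f x + c \<le> b" using real_arch_simple by blast
      from *[of b] obtain n where n: "?S n (T x) < - real b" by blast
      have "?S (Suc n) x < - real c" using n b unfolding step by simp
      then show ?thesis by blast
    qed
    then show "x \<in> A" using x by (auto simp: A_def)
  next
    fix x assume "x \<in> A"
    then have x: "x \<in> space M" and *: "\<And>c::nat. \<exists>n. ?S n x < - real c" by (auto simp: A_def)
    have "\<exists>n. ?S n (T x) < - real c" for c
    proof -
      obtain b :: nat where b: "c - f x \<le> b" using real_arch_simple by blast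
      from *[of b] obtain n where n: "?S n x < - real b" by blast
      \<comment> \<open>The case \<open>n = 0\<close> is excluded because the empty sum
        \<open>0\<close> is not below \<open>- real b\<close>.\<close>
      then obtain k where k: "n = Suc k" by (cases n) auto
      have "?S k (T x) < - real c" using n b unfolding k step by simp
      then show ?thesis by blast
    qed
    then show "x \<in> T -` A \<inter> space M" using x Tsp by (auto simp: A_def)
  qed
  then have "prob A \<in> {0, 1}" by (intro erg A)
  moreover have "prob A \<noteq> 1"
  proof
    assume "prob A = 1"
    then have AE: "AE x in M. x \<in> A" by (simp add: prob_eq_1)
    have mm[measurable]: "?m n \<in> borel_measurable M" for n
    proof (induction n)
      case (Suc n)
      then show ?case using measurable_compose[OF T Suc] by simp
    qed simp
    have "(\<lambda>n. \<integral>x. f x * indicator {x. ?m n x < 0} x \<partial>M) \<longlonglongrightarrow> (\<integral>x. f x \<partial>M)"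
    proof (rule integral_dominated_convergence[where w="\<lambda>x. norm (f x)"])
      show "AE x in M. (\<lambda>n. f x * indicator {x. ?m n x < 0} x) \<longlonglongrightarrow> f x"
        using AE
      proof eventually_elim
        case (elim x)
        then have "\<exists>n. ?S n x < - real 0" unfolding A_def by blast
        then obtain k where k: "?S k x < 0" by auto
        have "?m n x < 0" if "k \<le> n" for n using ergodic_min_le_sum[OF that] k by (rule le_less_trans)
        then have "eventually (\<lambda>n. f x * indicator {x. ?m n x < 0} x = f x) sequentially"
          unfolding eventually_sequentially by (intro exI[of _ k]) (simp add: indicator_def)
        then show ?case by (rule tendsto_eventually)
      qed
      show "AE x in M. norm (f x * indicator {x. ?m n x < 0} x) \<le> norm (f x)" for n
        by (auto simp: indicator_def)
    qed (use f in \<open>auto intro: integrable_norm\<close>)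
    then have "expectation f \<le> 0"
      by (rule LIMSEQ_le_const2) (use maximal_ergodic_inequality[OF T pres f] in blast)
    then show False using pos by simp
  qed
  ultimately have "prob A = 0" by auto
  then have "AE x in M. x \<notin> A" using AE_iff_measurable[OF A] A by (simp add: AE_not_in emeasure_eq_measure null_setsI)
  then show ?thesis
  proof (rule AE_mp, intro AE_I2 impI)
    fix x assume "x \<in> space M" "x \<notin> A"
    then obtain c :: nat where "\<And>n. - real c \<le> ?S n x" by (auto simp: A_def not_less)
    then show "\<exists>C. \<forall>n. C \<le> ?S n x" by blast
  qed
qed

section \<open>Branching in a fixed environment\<close>

text \<open>Independence makes the joint law a product, so Tonelli applies. The inner variable runs
  over \<open>M\<close> again and plays the role of an independent copy.\<close>

lemma (in prob_space) indep_var_nn_integral_iterated: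
  assumes ind: "indep_var S A T B"
    and f[measurable]: "case_prod f \<in> borel_measurable (S \<Otimes>\<^sub>M T)"
  shows "(\<integral>\<^sup>+\<omega>. f (A \<omega>) (B \<omega>) \<partial>M) = (\<integral>\<^sup>+\<omega>. \<integral>\<^sup>+\<omega>'. f (A \<omega>) (B \<omega>') \<partial>M \<partial>M)"
proof -
  have A[measurable]: "A \<in> measurable M S" and B[measurable]: "B \<in> measurable M T"
    and eq: "distr M S A \<Otimes>\<^sub>M distr M T B = distr M (S \<Otimes>\<^sub>M T) (\<lambda>x. (A x, B x))"
    using ind by (auto simp: indep_var_distribution_eq)
  interpret B: prob_space "distr M T B" by (rule prob_space_distr) simp
  have "(\<integral>\<^sup>+\<omega>. f (A \<omega>) (B \<omega>) \<partial>M) = (\<integral>\<^sup>+z. case_prod f z \<partial>distr M (S \<Otimes>\<^sub>M T) (\<lambda>x. (A x, B x)))"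
    by (subst nn_integral_distr) auto
  also have "\<dots> = (\<integral>\<^sup>+x. \<integral>\<^sup>+y. f x y \<partial>distr M T B \<partial>distr M S A)"
    unfolding eq[symmetric] by (subst B.nn_integral_fst[symmetric]) (auto cong: measurable_cong_sets)
  also have "\<dots> = (\<integral>\<^sup>+\<omega>. \<integral>\<^sup>+y. f (A \<omega>) y \<partial>distr M T B \<partial>M)"
    by (subst nn_integral_distr) auto
  also have "\<dots> = (\<integral>\<^sup>+\<omega>. \<integral>\<^sup>+\<omega>'. f (A \<omega>) (B \<omega>') \<partial>M \<partial>M)"
  proof (rule nn_integral_cong)
    fix \<omega> assume "\<omega> \<in> space M"
    then have [measurable]: "A \<omega> \<in> space S" using A by (rule measurable_space[rotated])
    have "(\<lambda>y. case_prod f (A \<omega>, y)) \<in> borel_measurable T" by measurable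
    then show "(\<integral>\<^sup>+y. f (A \<omega>) y \<partial>distr M T B) = (\<integral>\<^sup>+\<omega>'. f (A \<omega>) (B \<omega>') \<partial>M)"
      by (subst nn_integral_distr) auto
  qed
  finally show ?thesis .
qed

text \<open>The cross terms vanish because the summands are independent and centred. Integrability
  is carried through the induction, since the product formula asks for it.\<close>

lemma (in prob_space) expectation_square_sum_indep:
  fixes Y :: "'i \<Rightarrow> 'a \<Rightarrow> real"
  assumes "finite I" "indep_vars (\<lambda>_. borel) Y I"
    and "\<And>i. i \<in> I \<Longrightarrow> integrable M (Y i)" "\<And>i. i \<in> I \<Longrightarrow> integrable M (\<lambda>\<omega>. (Y i \<omega>)\<^sup>2)"
    and "\<And>i. i \<in> I \<Longrightarrow> expectation (Y i) = 0"
  shows "integrable M (\<lambda>\<omega>. (\<Sum>i\<in>I. Y i \<omega>)\<^sup>2) \<and>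
    expectation (\<lambda>\<omega>. (\<Sum>i\<in>I. Y i \<omega>)\<^sup>2) = (\<Sum>i\<in>I. expectation (\<lambda>\<omega>. (Y i \<omega>)\<^sup>2))"
  using assms
proof (induction I rule: finite_induct)
  case (insert i I)
  have IH: "integrable M (\<lambda>\<omega>. (\<Sum>i\<in>I. Y i \<omega>)\<^sup>2)"
    "expectation (\<lambda>\<omega>. (\<Sum>i\<in>I. Y i \<omega>)\<^sup>2) = (\<Sum>i\<in>I. expectation (\<lambda>\<omega>. (Y i \<omega>)\<^sup>2))"
    using insert by (auto intro: indep_vars_subset)
  have ind: "indep_var borel (Y i) borel (\<lambda>\<omega>. \<Sum>i\<in>I. Y i \<omega>)"
    using insert by (intro indep_vars_sum) auto
  have S: "integrable M (\<lambda>\<omega>. \<Sum>i\<in>I. Y i \<omega>)" using insert by auto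
  have P: "integrable M (\<lambda>\<omega>. Y i \<omega> * (\<Sum>i\<in>I. Y i \<omega>))"
    "expectation (\<lambda>\<omega>. Y i \<omega> * (\<Sum>i\<in>I. Y i \<omega>)) = 0"
    using indep_var_integrable[OF ind _ S] indep_var_lebesgue_integral[OF ind _ S] insert by auto
  have sq: "(\<Sum>i\<in>insert i I. Y i \<omega>)\<^sup>2 = (Y i \<omega>)\<^sup>2 + (\<Sum>i\<in>I. Y i \<omega>)\<^sup>2 + 2 * (Y i \<omega> * (\<Sum>i\<in>I. Y i \<omega>))" for \<omega>
    using insert by (simp add: power2_eq_square algebra_simps)
  show ?case unfolding sq using IH P insert by simp
qed simp

section \<open>Truncation of the normalised offspring number\<close>

text \<open>This is \<open>E[Y; Y > t]\<close> for the normalised offspring number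
  \<open>Y = k / offspring_mean q\<close>.\<close>

definition mean_excess :: "nat pmf \<Rightarrow> real \<Rightarrow> real" where
  "mean_excess q t = (\<integral>k. real k / offspring_mean q * indicator {k. t < real k / offspring_mean q} k \<partial>measure_pmf q)"

lemma
  assumes "summable (\<lambda>k. real k * pmf q k)"
  shows integrable_pmf_real: "integrable (measure_pmf q) real"
    and integral_pmf_real: "(\<integral>k. real k \<partial>measure_pmf q) = offspring_mean q"
proof -
  have *: "integrable (count_space UNIV) (\<lambda>k. pmf q k *\<^sub>R real k)"
    using assms by (simp add: integrable_count_space_nat_iff mult.commute)
  then show "integrable (measure_pmf q) real"
    by (subst measure_pmf_eq_density) (simp add: integrable_density)
  have "(\<integral>k. real k \<partial>measure_pmf q) = (\<integral>k. pmf q k *\<^sub>R real k \<partial>count_space UNIV)"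
    by (subst measure_pmf_eq_density) (simp add: integral_density)
  then show "(\<integral>k. real k \<partial>measure_pmf q) = offspring_mean q"
    using * by (simp add: integral_count_space_nat offspring_mean_def mult.commute)
qed

text \<open>Split \<open>Y = a + b\<close> at level \<open>t\<close>. Since \<open>Y\<close> has
  mean 1, \<open>Y - 1\<close> is the centred \<open>a - s\<close> plus \<open>b\<close> minus
  \<open>mean_excess q t\<close>. The centred parts sum to \<open>S\<close>, of variance at most
  \<open>card I * t\<close>; the two remaining parts each contribute
  \<open>card I * mean_excess q t\<close>, whence the factor 2.\<close>

lemma (in prob_space) nn_integral_abs_centered_sum_le:
  fixes X :: "'i \<Rightarrow> 'a \<Rightarrow> nat" and t :: real
  assumes I: "finite I" and ind: "indep_vars (\<lambda>_. count_space UNIV) X I"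
    and law: "\<And>i. i \<in> I \<Longrightarrow> distr M (count_space UNIV) (X i) = measure_pmf q"
    and sm: "summable (\<lambda>k. real k * pmf q k)" and pos: "0 < offspring_mean q" and t: "0 < t"
  shows "(\<integral>\<^sup>+\<omega>. \<bar>\<Sum>i\<in>I. (real (X i \<omega>) / offspring_mean q - 1)\<bar> \<partial>M)
    \<le> ennreal (sqrt (card I * t) + 2 * card I * mean_excess q t)"
proof (cases "I = {}")
  case False
  define m where "m = offspring_mean q"
  define a where "a k = real k / m * indicator {k. real k / m \<le> t} k" for k
  define b where "b k = real k / m * indicator {k. t < real k / m} k" for k
  define s where "s = (\<integral>k. a k \<partial>measure_pmf q)"
  have m: "0 < m" using pos by (simp add: m_def)
  have ab: "a k + b k = real k / m" for k by (auto simp: a_def b_def indicator_def)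
  have a0: "0 \<le> a k" and at: "a k \<le> t" and b0: "0 \<le> b k" for k
    using m t by (auto simp: a_def b_def indicator_def)
  have ik: "integrable (measure_pmf q) (\<lambda>k. real k / m)"
    using integrable_pmf_real[OF sm] by simp
  have ia: "integrable (measure_pmf q) a" and ib: "integrable (measure_pmf q) b"
    by (rule Bochner_Integration.integrable_bound[OF ik];
        use m in \<open>auto simp: a_def b_def indicator_def\<close>)+
  have ia2: "integrable (measure_pmf q) (\<lambda>k. (a k - s)\<^sup>2)"
  proof (rule measure_pmf.integrable_const_bound[where B="(t + \<bar>s\<bar>)\<^sup>2"])
    have "\<bar>a k - s\<bar> \<le> \<bar>t + \<bar>s\<bar>\<bar>" for k using a0[of k] at[of k] by linarith
    then show "AE k in measure_pmf q. norm ((a k - s)\<^sup>2) \<le> (t + \<bar>s\<bar>)\<^sup>2"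
      by (simp add: abs_le_square_iff)
  qed simp
  have ex: "mean_excess q t = (\<integral>k. b k \<partial>measure_pmf q)"
    by (simp add: mean_excess_def b_def m_def)
  have s1: "s + mean_excess q t = 1"
  proof -
    have "s + mean_excess q t = (\<integral>k. a k + b k \<partial>measure_pmf q)"
      using ia ib by (simp add: s_def ex)
    also have "\<dots> = 1" unfolding ab using integral_pmf_real[OF sm] m by (simp add: m_def)
    finally show ?thesis .
  qed
  have e0: "0 \<le> mean_excess q t" unfolding ex using b0 by simp
  have s0: "0 \<le> s" unfolding s_def using a0 by simp
  \<comment> \<open>From \<open>0 \<le> a \<le> t\<close> follows \<open>a^2 \<le> t * a\<close>,
    and \<open>a\<close> has mean \<open>s \<le> 1\<close>.\<close>
  have var: "(\<integral>k. (a k - s)\<^sup>2 \<partial>measure_pmf q) \<le> t"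
  proof -
    have i2: "integrable (measure_pmf q) (\<lambda>k. (a k)\<^sup>2)"
      by (rule measure_pmf.integrable_const_bound[where B="t\<^sup>2"])
        (use a0 at t in \<open>auto intro!: power_mono\<close>)
    have "(\<integral>k. (a k - s)\<^sup>2 \<partial>measure_pmf q) = (\<integral>k. (a k)\<^sup>2 \<partial>measure_pmf q) - s\<^sup>2"
      using measure_pmf.variance_eq[OF ia i2] by (simp add: s_def)
    also have "\<dots> \<le> (\<integral>k. (a k)\<^sup>2 \<partial>measure_pmf q)" by simp
    also have "\<dots> \<le> (\<integral>k. t * a k \<partial>measure_pmf q)"
      using a0 at by (intro integral_mono i2) (auto simp: ia power2_eq_square intro: mult_right_mono)
    also have "\<dots> = t * s" by (simp add: s_def)
    also have "\<dots> \<le> t * 1" using s1 e0 t by (intro mult_left_mono) auto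
    finally show ?thesis by simp
  qed
  have Xm[measurable]: "X i \<in> measurable M (count_space UNIV)" if "i \<in> I" for i
    using ind that by (auto simp: indep_vars_def)
  have tr: "integrable M (\<lambda>\<omega>. g (X i \<omega>)) \<and> expectation (\<lambda>\<omega>. g (X i \<omega>)) = (\<integral>k. g k \<partial>measure_pmf q)"
    if "i \<in> I" "integrable (measure_pmf q) g" for i and g :: "nat \<Rightarrow> real"
  proof -
    have "integrable (distr M (count_space UNIV) (X i)) g"
      "(\<integral>k. g k \<partial>distr M (count_space UNIV) (X i)) = (\<integral>k. g k \<partial>measure_pmf q)"
      using that law[OF that(1)] by auto
    then show ?thesis using Xm[OF that(1)] by (simp add: integrable_distr_eq integral_distr)
  qed
  define S where "S \<omega> = (\<Sum>i\<in>I. a (X i \<omega>) - s)" for \<omega>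
  define N where "N = real (card I)"
  have N: "0 < N" using I False by (simp add: N_def card_gt_0_iff)
  \<comment> \<open>In place of Cauchy-Schwarz, \<open>\<bar>S\<bar> \<le> (S^2 / r + r) / 2\<close>
    is used pointwise; this choice of \<open>r\<close> turns the expected bound into exactly
    \<open>r\<close>. The empty index set was split off because \<open>r\<close> is a
    divisor.\<close>
  define r where "r = sqrt (N * t)"
  have r: "0 < r" "r * r = N * t" using N t by (auto simp: r_def)
  have S2: "integrable M (\<lambda>\<omega>. (S \<omega>)\<^sup>2)" "expectation (\<lambda>\<omega>. (S \<omega>)\<^sup>2) \<le> N * t"
  proof -
    have *: "integrable M (\<lambda>\<omega>. (S \<omega>)\<^sup>2) \<and>
      expectation (\<lambda>\<omega>. (S \<omega>)\<^sup>2) = (\<Sum>i\<in>I. expectation (\<lambda>\<omega>. (a (X i \<omega>) - s)\<^sup>2))"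
      unfolding S_def
    proof (rule expectation_square_sum_indep[OF I])
      show "indep_vars (\<lambda>_. borel) (\<lambda>i \<omega>. a (X i \<omega>) - s) I"
        by (rule indep_vars_compose2[OF ind]) simp
      fix i assume i: "i \<in> I"
      show "integrable M (\<lambda>\<omega>. a (X i \<omega>) - s)" "integrable M (\<lambda>\<omega>. (a (X i \<omega>) - s)\<^sup>2)"
        using tr[OF i, of a] tr[OF i ia2] ia by auto
      show "expectation (\<lambda>\<omega>. a (X i \<omega>) - s) = 0"
        using tr[OF i, of a] ia by (simp add: s_def prob_space)
    qed
    then show "integrable M (\<lambda>\<omega>. (S \<omega>)\<^sup>2)" by simp
    have "(\<Sum>i\<in>I. expectation (\<lambda>\<omega>. (a (X i \<omega>) - s)\<^sup>2)) \<le> (\<Sum>i\<in>I. t)"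
      using tr[OF _ ia2] var by (intro sum_mono) auto
    then show "expectation (\<lambda>\<omega>. (S \<omega>)\<^sup>2) \<le> N * t" using * by (simp add: N_def)
  qed
  define D where "D \<omega> = ((S \<omega>)\<^sup>2 / r + r) / 2 + (\<Sum>i\<in>I. b (X i \<omega>)) + N * mean_excess q t" for \<omega>
  have bd: "\<bar>\<Sum>i\<in>I. (real (X i \<omega>) / m - 1)\<bar> \<le> D \<omega>" for \<omega>
  proof -
    have "(real (X i \<omega>) / m - 1) = (a (X i \<omega>) - s) + b (X i \<omega>) - mean_excess q t" for i
      using ab[of "X i \<omega>"] s1 by linarith
    then have "(\<Sum>i\<in>I. (real (X i \<omega>) / m - 1)) = S \<omega> + (\<Sum>i\<in>I. b (X i \<omega>)) - N * mean_excess q t"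
      by (simp add: S_def N_def sum.distrib sum_subtractf)
    moreover have "\<bar>S \<omega>\<bar> \<le> ((S \<omega>)\<^sup>2 / r + r) / 2"
    proof -
      have "0 \<le> (\<bar>S \<omega>\<bar> - r)\<^sup>2" by simp
      then have "2 * \<bar>S \<omega>\<bar> * r \<le> (S \<omega>)\<^sup>2 + r * r" by (simp add: power2_eq_square algebra_simps)
      then show ?thesis using r by (simp add: field_simps)
    qed
    moreover have "0 \<le> (\<Sum>i\<in>I. b (X i \<omega>))" using b0 by (simp add: sum_nonneg)
    moreover have "0 \<le> N * mean_excess q t" using N e0 by simp
    ultimately show ?thesis unfolding D_def by linarith
  qed
  have iD: "integrable M D" unfolding D_def using S2 tr[OF _ ib] by auto
  have "expectation D = (expectation (\<lambda>\<omega>. (S \<omega>)\<^sup>2) / r + r) / 2 + N * mean_excess q t + N * mean_excess q t"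
    unfolding D_def using S2 tr[OF _ ib] by (simp add: prob_space ex N_def)
  also have "\<dots> \<le> (N * t / r + r) / 2 + N * mean_excess q t + N * mean_excess q t"
    using S2 r by (simp add: divide_right_mono)
  also have "\<dots> = r + 2 * N * mean_excess q t" using r by (simp add: field_simps)
  finally have ED: "expectation D \<le> r + 2 * N * mean_excess q t" .
  have "(\<integral>\<^sup>+\<omega>. \<bar>\<Sum>i\<in>I. (real (X i \<omega>) / m - 1)\<bar> \<partial>M) \<le> (\<integral>\<^sup>+\<omega>. ennreal (D \<omega>) \<partial>M)"
    by (intro nn_integral_mono ennreal_leI bd)
  also have "\<dots> = ennreal (expectation D)"
    using iD bd by (intro nn_integral_eq_integral) (auto intro: order_trans[OF abs_ge_zero])
  also have "\<dots> \<le> ennreal (r + 2 * N * mean_excess q t)" by (intro ennreal_leI ED)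
  finally show ?thesis by (simp add: r_def N_def m_def)
qed simp

section \<open>Generation sizes and increments of the normalised process\<close>

text \<open>The two arrays may live on different spaces: this identifies the generation sizes of the
  given variables with those built from the coordinate maps of a product space.\<close>

lemma bp_Z_cong:
  assumes "\<And>k i. k < n \<Longrightarrow> 1 \<le> i \<Longrightarrow> X k i \<omega> = X' k i \<omega>'"
  shows "bp_Z X n \<omega> = bp_Z X' n \<omega>'"
  using assms by (induction n) auto

text \<open>The number of summands is random but takes countably many values, so it suffices to
  treat each fixed number \<open>y\<close> of summands.\<close>

lemma measurable_bp_Z:
  assumes "\<And>k i. k < n \<Longrightarrow> 1 \<le> i \<Longrightarrow> X k i \<in> measurable N (count_space UNIV)"
  shows "bp_Z X n \<in> measurable N (count_space UNIV)"
  using assms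
proof (induction n)
  case (Suc n)
  have Z: "bp_Z X n \<in> measurable N (count_space UNIV)" using Suc by auto
  have S: "(\<lambda>\<omega>. \<Sum>i = 1..y. X n i \<omega>) \<in> measurable N (count_space UNIV)" for y
    using Suc.prems by (intro measurable_sum_nat) auto
  show ?case using measurable_compose_countable[OF S Z] by simp
qed simp

context prob_space
begin

text \<open>The quenched situation: \<open>M\<close> stands for the law given one environment, and
  \<open>q n\<close> is the offspring law of generation \<open>n\<close> in it.\<close>

context
  fixes X :: "nat \<Rightarrow> nat \<Rightarrow> 'a \<Rightarrow> nat" and q :: "nat \<Rightarrow> nat pmf"
  assumes ind: "indep_vars (\<lambda>_. count_space UNIV) (\<lambda>(n, i). X n i) (UNIV \<times> {1..})"
    and law: "\<And>n i. 1 \<le> i \<Longrightarrow> distr M (count_space UNIV) (X n i) = measure_pmf (q n)"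
    and sm: "\<And>n. summable (\<lambda>k. real k * pmf (q n) k)"
    and pos: "\<And>n. 0 < offspring_mean (q n)"
begin

lemma measurable_offspring: "1 \<le> i \<Longrightarrow> X n i \<in> measurable M (count_space UNIV)"
  using ind by (force simp: indep_vars_def)

text \<open>\<open>bp_Z X n\<close> is a function of the generations below \<open>n\<close>, and the
  offspring numbers of generation \<open>n\<close> form a disjoint block of the independent family.
  The size of generation \<open>n\<close> can therefore be frozen while its offspring are
  averaged.\<close>

lemma nn_integral_generation_step:
  fixes h :: "nat \<Rightarrow> nat \<Rightarrow> ennreal"
  shows "(\<integral>\<^sup>+\<omega>. h (bp_Z X n \<omega>) (bp_Z X (Suc n) \<omega>) \<partial>M) =
    (\<integral>\<^sup>+\<omega>. \<integral>\<^sup>+\<omega>'. h (bp_Z X n \<omega>) (\<Sum>i = 1..bp_Z X n \<omega>. X n i \<omega>') \<partial>M \<partial>M)"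
proof -
  let ?A = "{..<n} \<times> {1::nat..}" and ?B = "{n} \<times> {1::nat..}"
  let ?C = "\<lambda>k i (f :: nat \<times> nat \<Rightarrow> nat). f (k, i)"
  let ?R = "\<lambda>\<omega>. restrict (\<lambda>j. (case j of (n, i) \<Rightarrow> X n i) \<omega>)"
  let ?MA = "PiM ?A (\<lambda>_. count_space UNIV) :: (nat \<times> nat \<Rightarrow> nat) measure"
  let ?MB = "PiM ?B (\<lambda>_. count_space UNIV) :: (nat \<times> nat \<Rightarrow> nat) measure"
  have *: "indep_var ?MA (\<lambda>\<omega>. ?R \<omega> ?A) ?MB (\<lambda>\<omega>. ?R \<omega> ?B)"
    by (rule indep_var_restrict[OF ind]) auto
  \<comment> \<open>With the coordinate maps \<open>?C\<close> in place of \<open>X\<close>, the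
    size of generation \<open>n\<close> becomes a function of the first block alone.\<close>
  have Z: "bp_Z ?C n (?R \<omega> ?A) = bp_Z X n \<omega>" for \<omega>
    by (intro bp_Z_cong) auto
  have [measurable]: "bp_Z ?C n \<in> measurable ?MA (count_space UNIV)"
    by (intro measurable_bp_Z measurable_component_singleton) auto
  have [measurable]: "(\<lambda>f. \<Sum>i = 1..y. f (n, i)) \<in> measurable ?MB (count_space UNIV)" for y
    by (intro measurable_sum_nat measurable_component_singleton) auto
  have "(\<lambda>z. h y (\<Sum>i = 1..y. snd z (n, i))) \<in> borel_measurable (?MA \<Otimes>\<^sub>M ?MB)" for y
    by (rule measurable_compose[where g="h y" and N="count_space UNIV"]) measurable
  then have "(\<lambda>z. h (bp_Z ?C n (fst z)) (\<Sum>i = 1..bp_Z ?C n (fst z). snd z (n, i)))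
      \<in> borel_measurable (?MA \<Otimes>\<^sub>M ?MB)"
    by (rule measurable_compose_countable[where g="\<lambda>z. bp_Z ?C n (fst z)"]) measurable
  then have "(\<lambda>(u, v). h (bp_Z ?C n u) (\<Sum>i = 1..bp_Z ?C n u. v (n, i)))
      \<in> borel_measurable (?MA \<Otimes>\<^sub>M ?MB)"
    by (simp add: case_prod_beta')
  from indep_var_nn_integral_iterated[OF * this, unfolded Z] show ?thesis by simp
qed

lemma measurable_generation: "bp_Z X n \<in> measurable M (count_space UNIV)"
  by (intro measurable_bp_Z measurable_offspring)

text \<open>Once the size is frozen at \<open>y\<close>, the next generation is a sum of
  \<open>y\<close> terms of mean \<open>offspring_mean (q n)\<close>, so each generation contributes
  one factor.\<close>

lemma nn_integral_generation:
  "(\<integral>\<^sup>+\<omega>. ennreal (real (bp_Z X n \<omega>)) \<partial>M) = ennreal (\<Prod>k<n. offspring_mean (q k))"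
proof (induction n)
  case 0
  show ?case by (simp add: emeasure_space_1)
next
  case (Suc n)
  have X1: "(\<integral>\<^sup>+\<omega>. ennreal (real (X n i \<omega>)) \<partial>M) = ennreal (offspring_mean (q n))" if "1 \<le> i" for i
  proof -
    have "(\<integral>\<^sup>+\<omega>. ennreal (real (X n i \<omega>)) \<partial>M) = (\<integral>\<^sup>+k. ennreal (real k) \<partial>measure_pmf (q n))"
      unfolding law[OF that, symmetric]
      by (subst nn_integral_distr) (auto intro: measurable_offspring that)
    also have "\<dots> = ennreal (offspring_mean (q n))"
      using integrable_pmf_real[OF sm] integral_pmf_real[OF sm] by (subst nn_integral_eq_integral) auto
    finally show ?thesis .
  qed
  have S: "(\<integral>\<^sup>+\<omega>'. ennreal (real (\<Sum>i = 1..y. X n i \<omega>')) \<partial>M) = ennreal (offspring_mean (q n)) * ennreal (real y)" for y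
  proof -
    have "(\<integral>\<^sup>+\<omega>'. ennreal (real (\<Sum>i = 1..y. X n i \<omega>')) \<partial>M) = (\<Sum>i = 1..y. \<integral>\<^sup>+\<omega>'. ennreal (real (X n i \<omega>')) \<partial>M)"
      by (subst nn_integral_sum[symmetric])
        (auto simp: sum_ennreal intro!: measurable_compose[OF measurable_offspring])
    also have "\<dots> = (\<Sum>i = 1..y. ennreal (offspring_mean (q n)))" by (intro sum.cong X1) auto
    finally show ?thesis by (simp add: ennreal_of_nat_eq_real_of_nat mult.commute)
  qed
  have "(\<integral>\<^sup>+\<omega>. ennreal (real (bp_Z X (Suc n) \<omega>)) \<partial>M) =
      (\<integral>\<^sup>+\<omega>. ennreal (offspring_mean (q n)) * ennreal (real (bp_Z X n \<omega>)) \<partial>M)"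
    using nn_integral_generation_step[of "\<lambda>_ z. ennreal (real z)" n] unfolding S by simp
  also have "\<dots> = ennreal (offspring_mean (q n)) * ennreal (\<Prod>k<n. offspring_mean (q k))"
    by (subst nn_integral_cmult) (auto simp: Suc.IH intro!: measurable_compose[OF measurable_generation])
  finally show ?case
    using pos by (simp add: ennreal_mult'' less_imp_le prod_nonneg mult.commute)
qed

text \<open>Given size \<open>y\<close>, the increment is \<open>1 / P n\<close> times a sum of
  \<open>y\<close> centred terms, so its absolute mean is at most
  \<open>(sqrt (y * t) + 2 * y * e) / P n\<close>. The square root is replaced by its tangent at
  \<open>y = P n\<close>; the bound is then affine in \<open>y\<close>, and only the mean
  \<open>P n\<close> of the generation size enters.\<close>

lemma nn_integral_abs_increment_le:
  assumes t: "0 < t"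
  defines "P \<equiv> \<lambda>n. \<Prod>k<n. offspring_mean (q k)"
  shows "(\<integral>\<^sup>+\<omega>. \<bar>real (bp_Z X (Suc n) \<omega>) / P (Suc n) - real (bp_Z X n \<omega>) / P n\<bar> \<partial>M)
    \<le> ennreal (sqrt (t / P n) + 2 * mean_excess (q n) t)"
proof -
  define m where "m = offspring_mean (q n)"
  define e where "e = mean_excess (q n) t"
  define r where "r = sqrt (P n * t)"
  have m: "0 < m" by (simp add: m_def pos)
  have Pp: "0 < P n" by (auto simp: P_def pos intro!: prod_pos)
  have PS: "P (Suc n) = P n * m" by (simp add: P_def m_def)
  have e: "0 \<le> e" unfolding e_def mean_excess_def using pos[of n] by (auto intro!: integral_nonneg)
  have r: "0 < r" "r * r = P n * t" using Pp t by (auto simp: r_def)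
  \<comment> \<open>Slope and intercept of the affine bound: the tangent to
    \<open>sqrt (y * t)\<close> at \<open>y = P n\<close> is \<open>t / (2 * r) * y + r / 2\<close>,
    and the excess adds \<open>2 * e\<close> to the slope; all is divided by
    \<open>P n\<close>.\<close>
  define c where "c = (t / (2 * r) + 2 * e) / P n"
  define d where "d = r / (2 * P n)"
  have cd: "0 \<le> c" "0 \<le> d" using t r e Pp by (auto simp: c_def d_def)
  have blk: "(\<integral>\<^sup>+\<omega>'. \<bar>real (\<Sum>i = 1..y. X n i \<omega>') / P (Suc n) - real y / P n\<bar> \<partial>M)
      \<le> ennreal (c * y + d)" for y
  proof -
    have "\<bar>real (\<Sum>i = 1..y. X n i \<omega>') / P (Suc n) - real y / P n\<bar> =
        1 / P n * \<bar>\<Sum>i = 1..y. (real (X n i \<omega>') / m - 1)\<bar>" for \<omega>'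
    proof -
      have "real (\<Sum>i = 1..y. X n i \<omega>') / P (Suc n) - real y / P n =
          1 / P n * (\<Sum>i = 1..y. (real (X n i \<omega>') / m - 1))"
        using Pp m by (simp add: PS sum_subtractf sum_divide_distrib[symmetric] field_simps)
      then show ?thesis using Pp by (simp add: abs_mult)
    qed
    then have "(\<integral>\<^sup>+\<omega>'. \<bar>real (\<Sum>i = 1..y. X n i \<omega>') / P (Suc n) - real y / P n\<bar> \<partial>M) =
        (\<integral>\<^sup>+\<omega>'. ennreal (1 / P n) * ennreal \<bar>\<Sum>i = 1..y. (real (X n i \<omega>') / m - 1)\<bar> \<partial>M)"
      using Pp by (simp only: ennreal_mult''[OF abs_ge_zero])
    also have "\<dots> = ennreal (1 / P n) * (\<integral>\<^sup>+\<omega>'. \<bar>\<Sum>i = 1..y. (real (X n i \<omega>') / m - 1)\<bar> \<partial>M)"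
      by (intro nn_integral_cmult measurable_compose[OF _ measurable_ennreal] borel_measurable_abs
          borel_measurable_sum borel_measurable_diff borel_measurable_divide
          measurable_compose[OF measurable_offspring]) auto
    also have "\<dots> \<le> ennreal (1 / P n) * ennreal (sqrt (y * t) + 2 * y * e)"
    proof (intro mult_left_mono)
      \<comment> \<open>Generation \<open>n\<close> cut at \<open>y\<close> individuals is the
        subfamily over \<open>{n} \<times> {1..y}\<close> of the doubly indexed independent
        family.\<close>
      have "indep_vars (\<lambda>_. count_space UNIV) (\<lambda>(n, i). X n i) ({n} \<times> {1..y})"
        by (rule indep_vars_subset[OF ind]) auto
      from nn_integral_abs_centered_sum_le[OF _ this _ sm pos t, of n]
      have "(\<integral>\<^sup>+\<omega>'. \<bar>\<Sum>j\<in>{n} \<times> {1..y}. (real ((case j of (n, i) \<Rightarrow> X n i) \<omega>') / m - 1)\<bar> \<partial>M)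
          \<le> ennreal (sqrt (y * t) + 2 * y * e)"
        using law by (auto simp: m_def e_def card_cartesian_product)
      moreover have "(\<Sum>j\<in>{n} \<times> {1..y}. (real ((case j of (n, i) \<Rightarrow> X n i) \<omega>') / m - 1)) =
          (\<Sum>i = 1..y. (real (X n i \<omega>') / m - 1))" for \<omega>'
        by (rule sum.reindex_bij_witness[of _ "Pair n" snd]) auto
      ultimately show "(\<integral>\<^sup>+\<omega>'. \<bar>\<Sum>i = 1..y. (real (X n i \<omega>') / m - 1)\<bar> \<partial>M) \<le> ennreal (sqrt (y * t) + 2 * y * e)"
        by simp
    qed simp
    also have "\<dots> = ennreal (1 / P n * (sqrt (y * t) + 2 * y * e))"
      using Pp e t by (intro ennreal_mult[symmetric]) auto
    also have "\<dots> \<le> ennreal (c * y + d)"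
    proof (intro ennreal_leI)
      define u where "u = sqrt (y * t)"
      have u: "u * u = y * t" using t by (simp add: u_def)
      have "0 \<le> (u - r)\<^sup>2" by simp
      then have "2 * u * r \<le> y * t + r * r" by (simp add: u power2_eq_square algebra_simps)
      then have "u \<le> (y * t / r + r) / 2" using r by (simp add: field_simps)
      then have "1 / P n * (u + 2 * y * e) \<le> 1 / P n * ((y * t / r + r) / 2 + 2 * y * e)"
        using Pp by (intro mult_left_mono) auto
      also have "\<dots> = c * y + d" using Pp r(1) by (simp add: c_def d_def field_simps)
      finally show "1 / P n * (sqrt (y * t) + 2 * y * e) \<le> c * y + d" by (simp add: u_def)
    qed
    finally show ?thesis .
  qed
  have "(\<integral>\<^sup>+\<omega>. \<bar>real (bp_Z X (Suc n) \<omega>) / P (Suc n) - real (bp_Z X n \<omega>) / P n\<bar> \<partial>M) =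
      (\<integral>\<^sup>+\<omega>. \<integral>\<^sup>+\<omega>'. \<bar>real (\<Sum>i = 1..bp_Z X n \<omega>. X n i \<omega>') / P (Suc n) - real (bp_Z X n \<omega>) / P n\<bar> \<partial>M \<partial>M)"
    using nn_integral_generation_step[of "\<lambda>y z. ennreal \<bar>real z / P (Suc n) - real y / P n\<bar>" n] .
  also have "\<dots> \<le> (\<integral>\<^sup>+\<omega>. ennreal (c * bp_Z X n \<omega> + d) \<partial>M)"
    by (intro nn_integral_mono blk)
  also have "\<dots> = (\<integral>\<^sup>+\<omega>. ennreal c * ennreal (real (bp_Z X n \<omega>)) + ennreal d \<partial>M)"
    using cd by (simp add: ennreal_mult'')
  also have "\<dots> = ennreal c * ennreal (P n) + ennreal d"
    using measurable_compose[OF measurable_generation[of n], of "\<lambda>z. ennreal (real z)" borel]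
    by (simp add: nn_integral_add nn_integral_cmult nn_integral_generation P_def emeasure_space_1)
  also have "\<dots> = ennreal (c * P n + d)" using cd Pp by (simp add: ennreal_mult'')
  also have "c * P n + d = sqrt (t / P n) + 2 * e"
  proof -
    have 1: "t / r = r / P n" using r Pp by (simp add: field_simps)
    have "(r / P n)\<^sup>2 = t / P n" using r Pp by (simp add: power2_eq_square field_simps)
    then have 2: "sqrt (t / P n) = r / P n" using r Pp by (intro real_sqrt_unique) auto
    have "c * P n + d = t / r / 2 + 2 * e + r / P n / 2" using Pp r(1) by (simp add: c_def d_def)
    then show ?thesis by (simp add: 1 2)
  qed
  finally show ?thesis by (simp add: e_def)
qed

end

end

lemma ennreal_mean_excess:
  assumes "summable (\<lambda>k. real k * pmf q k)" "0 < offspring_mean q"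
  shows "ennreal (mean_excess q t) = (\<integral>\<^sup>+k. ennreal (real k / offspring_mean q *
    indicator {k. t < real k / offspring_mean q} k) \<partial>measure_pmf q)"
  unfolding mean_excess_def
proof (rule nn_integral_eq_integral[symmetric])
  have "integrable (measure_pmf q) (\<lambda>k. real k / offspring_mean q)"
    using integrable_pmf_real[OF assms(1)] by simp
  then show "integrable (measure_pmf q)
      (\<lambda>k. real k / offspring_mean q * indicator {k. t < real k / offspring_mean q} k)"
    by (rule Bochner_Integration.integrable_bound) (use assms in \<open>auto simp: indicator_def\<close>)
qed (use assms in auto)

section \<open>Disintegration over the environment\<close>

text \<open>As a series in the values \<open>pmf q k\<close>, the measure of \<open>A\<close>
  depends measurably on a parameter as soon as each of these values does.\<close>

lemma emeasure_pmf_nat: "emeasure (measure_pmf q) A = (\<Sum>k. indicator A k * ennreal (pmf q k))"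
proof -
  have "emeasure (measure_pmf q) A = (\<integral>\<^sup>+k. indicator A k \<partial>measure_pmf q)" by simp
  also have "\<dots> = (\<integral>\<^sup>+k. ennreal (pmf q k) * indicator A k \<partial>count_space UNIV)"
    by (rule nn_integral_measure_pmf)
  finally show ?thesis by (simp add: nn_integral_count_space_nat mult.commute)
qed

lemma nn_integral_pmf_nat:
  "(\<integral>\<^sup>+k. g k \<partial>measure_pmf q) = (\<Sum>k. ennreal (pmf q k) * g k)"
  by (simp add: nn_integral_measure_pmf nn_integral_count_space_nat)

definition offspring_space :: "(nat \<times> nat \<Rightarrow> nat) measure" where
  "offspring_space = PiM (UNIV \<times> {1..}) (\<lambda>_. count_space UNIV)"

text \<open>The quenched law of the whole offspring family in the environment \<open>x\<close>,
  written explicitly as a product; \<open>joint_law\<close> shows that it is a version of the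
  conditional law given the environment.\<close>

definition offspring_kernel :: "('e \<Rightarrow> nat pmf) \<Rightarrow> (nat \<Rightarrow> 'e) \<Rightarrow> (nat \<times> nat \<Rightarrow> nat) measure" where
  "offspring_kernel p x = PiM (UNIV \<times> {1..}) (\<lambda>(n, i). measure_pmf (p (x n)))"

lemma sets_offspring_kernel: "sets (offspring_kernel p x) = sets offspring_space"
  unfolding offspring_kernel_def offspring_space_def by (intro sets_PiM_cong) auto

lemma prob_space_offspring_kernel: "prob_space (offspring_kernel p x)"
  unfolding offspring_kernel_def by (intro prob_space_PiM) (auto intro: prob_space_measure_pmf)

lemma emeasure_offspring_kernel:
  assumes J: "finite J" "J \<subseteq> UNIV \<times> {1..}"
  shows "emeasure (offspring_kernel p x)
      (prod_emb (UNIV \<times> {1..}) (\<lambda>_. count_space UNIV) J (Pi\<^sub>E J F)) =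
    (\<Prod>j\<in>J. emeasure (measure_pmf (p (x (fst j)))) (F j))"
proof -
  have "prod_emb (UNIV \<times> {1..}) (\<lambda>_. count_space UNIV) J (Pi\<^sub>E J F) =
      prod_emb (UNIV \<times> {1..}) (\<lambda>(n, i). measure_pmf (p (x n))) J (Pi\<^sub>E J F)"
    by (simp add: prod_emb_def case_prod_beta')
  moreover have "emeasure (offspring_kernel p x)
      (prod_emb (UNIV \<times> {1..}) (\<lambda>(n, i). measure_pmf (p (x n))) J (Pi\<^sub>E J F)) =
    (\<Prod>j\<in>J. emeasure (case j of (n, i) \<Rightarrow> measure_pmf (p (x n))) (F j))"
    unfolding offspring_kernel_def using J
    by (intro emeasure_PiM_emb) (auto intro: prob_space_measure_pmf)
  ultimately show ?thesis by (simp add: case_prod_beta')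
qed

text \<open>The coordinates of a product measure are independent with the prescribed marginals.
  These are the hypotheses of the fixed-environment estimates, which thereby apply under every
  \<open>offspring_kernel p x\<close> whose offspring means are finite and positive.\<close>

lemma
  fixes p :: "'e \<Rightarrow> nat pmf" and x :: "nat \<Rightarrow> 'e"
  shows indep_vars_offspring_kernel:
    "prob_space.indep_vars (offspring_kernel p x) (\<lambda>_. count_space UNIV) (\<lambda>(n, i) f. f (n, i)) (UNIV \<times> {1..})"
    and distr_offspring_kernel:
    "1 \<le> i \<Longrightarrow> distr (offspring_kernel p x) (count_space UNIV) (\<lambda>f. f (n, i)) = measure_pmf (p (x n))"
proof -
  interpret K: prob_space "offspring_kernel p x" by (rule prob_space_offspring_kernel)
  have m: "(\<lambda>f. f j) \<in> measurable (offspring_kernel p x) (count_space UNIV)" if "j \<in> UNIV \<times> {1..}" for j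
    using measurable_component_singleton[OF that, of "\<lambda>_. count_space UNIV :: nat measure"]
    by (simp add: measurable_cong_sets[OF sets_offspring_kernel refl] offspring_space_def)
  have d: "distr (offspring_kernel p x) (count_space UNIV) (\<lambda>f. f (n, i)) = measure_pmf (p (x n))" if "1 \<le> i" for n i
  proof -
    have "distr (offspring_kernel p x) (count_space UNIV) (\<lambda>f. f (n, i)) =
        distr (offspring_kernel p x) (measure_pmf (p (x n))) (\<lambda>f. f (n, i))"
      by (rule distr_cong) auto
    also have "\<dots> = measure_pmf (p (x n))"
      using distr_PiM_component[of "UNIV \<times> {1..}" "\<lambda>(n, i). measure_pmf (p (x n))" "(n, i)"] that
      by (auto simp: offspring_kernel_def prob_space_measure_pmf)
    finally show ?thesis .
  qed
  show "1 \<le> i \<Longrightarrow> distr (offspring_kernel p x) (count_space UNIV) (\<lambda>f. f (n, i)) = measure_pmf (p (x n))"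
    by (rule d)
  have "K.indep_vars (\<lambda>_. count_space UNIV) (\<lambda>j f. f j) (UNIV \<times> {1..})"
  proof (subst K.indep_vars_iff_distr_eq_PiM')
    \<comment> \<open>Restriction to the index set is the identity on the product space, so the
      joint law of the coordinates is the kernel itself, which is the product of its
      marginals.\<close>
    have "distr (offspring_kernel p x) (PiM (UNIV \<times> {1..}) (\<lambda>_. count_space UNIV)) (\<lambda>f. \<lambda>j\<in>UNIV \<times> {1..}. f j) =
        distr (offspring_kernel p x) (offspring_kernel p x) (\<lambda>f. f)"
    proof (rule distr_cong)
      fix f assume "f \<in> space (offspring_kernel p x)"
      then show "(\<lambda>j\<in>UNIV \<times> {1..}. f j) = f"
        by (auto simp: offspring_kernel_def space_PiM PiE_iff extensional_restrict)
    qed (auto simp: sets_offspring_kernel offspring_space_def)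
    also have "\<dots> = offspring_kernel p x" by (rule distr_id2) simp
    also have "\<dots> = (\<Pi>\<^sub>M j\<in>UNIV \<times> {1..}. distr (offspring_kernel p x) (count_space UNIV) (\<lambda>f. f j))"
      by (subst offspring_kernel_def, intro PiM_cong) (auto simp: d)
    finally show "distr (offspring_kernel p x) (PiM (UNIV \<times> {1..}) (\<lambda>_. count_space UNIV)) (\<lambda>f. \<lambda>j\<in>UNIV \<times> {1..}. f j) =
        (\<Pi>\<^sub>M j\<in>UNIV \<times> {1..}. distr (offspring_kernel p x) (count_space UNIV) (\<lambda>f. f j))" .
  qed (auto intro: m)
  then show "K.indep_vars (\<lambda>_. count_space UNIV) (\<lambda>(n, i) f. f (n, i)) (UNIV \<times> {1..})"
    by (simp add: case_prod_beta')
qed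

context branching_process_random_env
begin

abbreviation "env_space \<equiv> (\<Pi>\<^sub>M n\<in>(UNIV :: nat set). E)"
abbreviation "env \<equiv> (\<lambda>\<omega> n. \<xi> n \<omega>)"
abbreviation "offspring \<equiv> (\<lambda>\<omega>. \<lambda>j\<in>UNIV \<times> {1..}. case_prod X j \<omega>)"

lemma measurable_env[measurable]: "env \<in> measurable M env_space"
  by (intro measurable_PiM_single') (auto intro: env_measurable measurable_space[OF env_measurable])

lemma measurable_offspring_number: "1 \<le> i \<Longrightarrow> X n i \<in> measurable M (count_space UNIV)"
  using offspring_cond_indep by (force simp: cond_indep_vars_def)

lemma measurable_offspring_family[measurable]: "offspring \<in> measurable M offspring_space"
  unfolding offspring_space_def
  by (intro measurable_restrict) (auto intro: measurable_offspring_number)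

lemma measurable_env_coordinate[measurable]: "(\<lambda>x. x n) \<in> measurable env_space E"
  by (rule measurable_component_singleton) simp

lemma borel_measurable_emeasure_offspring[measurable]:
  "(\<lambda>e. emeasure (measure_pmf (p e)) A) \<in> borel_measurable E"
  unfolding emeasure_pmf_nat using offspring_measurable by measurable

lemma borel_measurable_measure_offspring[measurable]:
  "(\<lambda>e. measure (measure_pmf (p e)) A) \<in> borel_measurable E"
  unfolding measure_def by measurable

text \<open>Measurability is checked on the generating cylinders, where the kernel is a finite
  product of measurable functions of single environment coordinates.\<close>

lemma measurable_offspring_kernel[measurable]:
  "offspring_kernel p \<in> measurable env_space (subprob_algebra offspring_space)"
proof -
  have "offspring_kernel p \<in> measurable env_space (prob_algebra offspring_space)"
  proof (rule measurable_prob_algebra_generated)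
    show "sets offspring_space = sigma_sets (\<Pi>\<^sub>E j\<in>UNIV \<times> {1..}. space (count_space UNIV))
        (prod_algebra (UNIV \<times> {1..}) (\<lambda>_. count_space UNIV))"
      unfolding offspring_space_def by (rule sets_PiM)
    show "Int_stable (prod_algebra (UNIV \<times> {1..}) (\<lambda>_. count_space UNIV))"
      by (rule Int_stable_prod_algebra)
    show "prod_algebra (UNIV \<times> {1..}) (\<lambda>_. count_space UNIV) \<subseteq>
        Pow (\<Pi>\<^sub>E j\<in>UNIV \<times> {1..}. space (count_space UNIV))"
      by (rule prod_algebra_sets_into_space)
    fix A :: "(nat \<times> nat \<Rightarrow> nat) set"
    assume "A \<in> prod_algebra (UNIV \<times> {1..}) (\<lambda>_. count_space UNIV)"
    then obtain J F where A: "A = prod_emb (UNIV \<times> {1..}) (\<lambda>_. count_space UNIV) J (Pi\<^sub>E J F)"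
      and J: "finite J" "J \<subseteq> UNIV \<times> {1..}" by (rule prod_algebraE)
    show "(\<lambda>x. emeasure (offspring_kernel p x) A) \<in> borel_measurable env_space"
      unfolding A emeasure_offspring_kernel[OF J] by measurable
  qed (auto simp: prob_space_offspring_kernel sets_offspring_kernel)
  then show ?thesis by (rule measurable_prob_algebraD)
qed

section \<open>Conditional probabilities given the environment\<close>

lemma subalgebra_env: "subalgebra M (env_algebra M E \<xi>)"
proof -
  have "env \<in> space M \<rightarrow> space env_space" by (auto intro: measurable_space[OF measurable_env])
  then show ?thesis
    unfolding subalgebra_def env_algebra_def
    by (auto simp: sets_vimage_algebra2 intro: measurable_sets[OF measurable_env])
qed

lemma env_finite_subalgebra: "finite_measure_subalgebra M (env_algebra M E \<xi>)"
  by unfold_locales (rule subalgebra_env)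

lemma measurable_env_algebra: "env \<in> measurable (env_algebra M E \<xi>) env_space"
  unfolding env_algebra_def by (rule measurable_vimage_algebra1) (auto intro: measurable_space[OF measurable_env])

text \<open>The conditional law is given for single values \<open>k\<close> only. Integrated over an
  environment event \<open>B\<close>, it becomes an identity between numbers that can be summed over
  \<open>k \<in> A\<close> by monotone convergence.\<close>

lemma emeasure_env_offspring:
  assumes i: "1 \<le> i" and B: "B \<in> sets (env_algebra M E \<xi>)"
  shows "emeasure M (B \<inter> {\<omega> \<in> space M. X n i \<omega> \<in> A}) =
    (\<integral>\<^sup>+\<omega>. indicator B \<omega> * emeasure (measure_pmf (p (\<xi> n \<omega>))) A \<partial>M)"
proof -
  interpret F: finite_measure_subalgebra M "env_algebra M E \<xi>" by (rule env_finite_subalgebra)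
  have BM[measurable]: "B \<in> sets M" using B subalgebra_env by (auto simp: subalgebra_def)
  note [measurable] = measurable_offspring_number[OF i] env_measurable offspring_measurable
  have pk: "emeasure M (B \<inter> {\<omega> \<in> space M. X n i \<omega> = k}) =
      (\<integral>\<^sup>+\<omega>. indicator B \<omega> * ennreal (pmf (p (\<xi> n \<omega>)) k) \<partial>M)" for k
  proof -
    let ?C = "{\<omega> \<in> space M. X n i \<omega> = k}"
    have ic: "integrable M (indicator ?C :: _ \<Rightarrow> real)" by (auto simp: less_top[symmetric])
    have ip: "integrable M (\<lambda>\<omega>. indicator B \<omega> * pmf (p (\<xi> n \<omega>)) k)"
      by (rule integrable_const_bound[where B=1]) (auto simp: indicator_def pmf_le_1)
    have "measure M (B \<inter> ?C) = (\<integral>\<omega>\<in>B. indicator ?C \<omega> \<partial>M)"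
      by (simp add: set_lebesgue_integral_def flip: indicator_inter_arith)
    also have "\<dots> = (\<integral>\<omega>\<in>B. real_cond_exp M (env_algebra M E \<xi>) (indicator ?C) \<omega> \<partial>M)"
      by (rule F.real_cond_exp_intA[OF ic B])
    also have "\<dots> = (\<integral>\<omega>\<in>B. pmf (p (\<xi> n \<omega>)) k \<partial>M)"
      using offspring_cond_distr[OF i, of n k]
      by (intro set_lebesgue_integral_cong_AE) (auto simp: prob_given_def)
    finally have "measure M (B \<inter> ?C) = (\<integral>\<omega>. indicator B \<omega> * pmf (p (\<xi> n \<omega>)) k \<partial>M)"
      by (simp add: set_lebesgue_integral_def)
    then have "emeasure M (B \<inter> ?C) = ennreal (\<integral>\<omega>. indicator B \<omega> * pmf (p (\<xi> n \<omega>)) k \<partial>M)"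
      by (simp add: emeasure_eq_measure)
    also have "\<dots> = (\<integral>\<^sup>+\<omega>. ennreal (indicator B \<omega> * pmf (p (\<xi> n \<omega>)) k) \<partial>M)"
      by (rule nn_integral_eq_integral[OF ip, symmetric]) simp
    finally show ?thesis by (simp add: ennreal_mult'' ennreal_indicator)
  qed
  have ind: "indicator (B \<inter> {\<omega> \<in> space M. X n i \<omega> \<in> A}) \<omega> =
      (\<Sum>k. indicator A k * indicator (B \<inter> {\<omega> \<in> space M. X n i \<omega> = k}) \<omega> :: ennreal)" if "\<omega> \<in> space M" for \<omega>
  proof -
    have "(\<lambda>k. if k = X n i \<omega> then indicator (B \<inter> {\<omega> \<in> space M. X n i \<omega> \<in> A}) \<omega> else 0 :: ennreal)
        sums indicator (B \<inter> {\<omega> \<in> space M. X n i \<omega> \<in> A}) \<omega>"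
      by (rule sums_single)
    also have "(\<lambda>k. if k = X n i \<omega> then indicator (B \<inter> {\<omega> \<in> space M. X n i \<omega> \<in> A}) \<omega> else 0 :: ennreal) =
        (\<lambda>k. indicator A k * indicator (B \<inter> {\<omega> \<in> space M. X n i \<omega> = k}) \<omega>)"
      using that by (auto simp: fun_eq_iff indicator_def)
    finally show ?thesis by (simp add: sums_iff)
  qed
  have "emeasure M (B \<inter> {\<omega> \<in> space M. X n i \<omega> \<in> A}) =
      (\<integral>\<^sup>+\<omega>. indicator (B \<inter> {\<omega> \<in> space M. X n i \<omega> \<in> A}) \<omega> \<partial>M)" by simp
  also have "\<dots> = (\<integral>\<^sup>+\<omega>. (\<Sum>k. indicator A k * indicator (B \<inter> {\<omega> \<in> space M. X n i \<omega> = k}) \<omega>) \<partial>M)"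
    by (intro nn_integral_cong ind)
  also have "\<dots> = (\<Sum>k. \<integral>\<^sup>+\<omega>. indicator A k * indicator (B \<inter> {\<omega> \<in> space M. X n i \<omega> = k}) \<omega> \<partial>M)"
    by (rule nn_integral_suminf) measurable
  also have "\<dots> = (\<Sum>k. \<integral>\<^sup>+\<omega>. indicator A k * (indicator B \<omega> * ennreal (pmf (p (\<xi> n \<omega>)) k)) \<partial>M)"
    by (simp add: nn_integral_cmult pk)
  also have "\<dots> = (\<integral>\<^sup>+\<omega>. (\<Sum>k. indicator A k * (indicator B \<omega> * ennreal (pmf (p (\<xi> n \<omega>)) k))) \<partial>M)"
    by (rule nn_integral_suminf[symmetric]) measurable
  also have "\<dots> = (\<integral>\<^sup>+\<omega>. indicator B \<omega> * emeasure (measure_pmf (p (\<xi> n \<omega>))) A \<partial>M)"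
    by (simp add: emeasure_pmf_nat mult.left_commute flip: ennreal_suminf_cmult)
  finally show ?thesis .
qed

text \<open>The right-hand side is measurable with respect to the environment and has the correct
  integral over each environment event, which characterises conditional expectation almost
  surely.\<close>

lemma prob_given_offspring:
  assumes i: "1 \<le> i"
  shows "AE \<omega> in M. prob_given M (env_algebra M E \<xi>) {\<omega> \<in> space M. X n i \<omega> \<in> A} \<omega> =
    measure (measure_pmf (p (\<xi> n \<omega>))) A"
  unfolding prob_given_def
proof -
  interpret F: finite_measure_subalgebra M "env_algebra M E \<xi>" by (rule env_finite_subalgebra)
  note [measurable] = measurable_offspring_number[OF i] env_measurable
  show "AE \<omega> in M. real_cond_exp M (env_algebra M E \<xi>) (indicator {\<omega> \<in> space M. X n i \<omega> \<in> A}) \<omega> =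
    measure (measure_pmf (p (\<xi> n \<omega>))) A"
  proof (rule F.real_cond_exp_charact)
    show ip: "integrable M (\<lambda>\<omega>. measure (measure_pmf (p (\<xi> n \<omega>))) A)"
      by (rule integrable_const_bound[where B=1]) auto
    have "(\<lambda>x. measure (measure_pmf (p (x n))) A) \<in> borel_measurable env_space" by measurable
    from measurable_compose[OF measurable_env_algebra this]
    show "(\<lambda>\<omega>. measure (measure_pmf (p (\<xi> n \<omega>))) A) \<in> borel_measurable (env_algebra M E \<xi>)" .
    fix B assume B: "B \<in> sets (env_algebra M E \<xi>)"
    then have BM[measurable]: "B \<in> sets M" using subalgebra_env by (auto simp: subalgebra_def)
    let ?C = "{\<omega> \<in> space M. X n i \<omega> \<in> A}"
    have ipB: "integrable M (\<lambda>\<omega>. indicator B \<omega> * measure (measure_pmf (p (\<xi> n \<omega>))) A)"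
      by (rule integrable_const_bound[where B=1]) (auto simp: indicator_def)
    have "ennreal (measure M (B \<inter> ?C)) = (\<integral>\<^sup>+\<omega>. ennreal (indicator B \<omega> * measure (measure_pmf (p (\<xi> n \<omega>))) A) \<partial>M)"
      using emeasure_env_offspring[OF i B, of n A]
      by (simp add: emeasure_eq_measure measure_pmf.emeasure_eq_measure ennreal_mult'' ennreal_indicator)
    also have "\<dots> = ennreal (\<integral>\<omega>. indicator B \<omega> * measure (measure_pmf (p (\<xi> n \<omega>))) A \<partial>M)"
      by (rule nn_integral_eq_integral[OF ipB]) simp
    finally show "(\<integral>\<omega>\<in>B. indicator ?C \<omega> \<partial>M) = (\<integral>\<omega>\<in>B. measure (measure_pmf (p (\<xi> n \<omega>))) A \<partial>M)"
      by (simp add: set_lebesgue_integral_def integral_nonneg flip: indicator_inter_arith)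
  qed (auto simp: less_top[symmetric])
qed

text \<open>Conditional independence factorises the conditional probability of the cylinder, and
  each factor is the corresponding offspring law. As \<open>J\<close> is finite, the exceptional
  null sets can be united.\<close>

lemma emeasure_env_offspring_cylinder:
  assumes B: "B \<in> sets (env_algebra M E \<xi>)" and J: "finite J" "J \<subseteq> UNIV \<times> {1..}"
  shows "emeasure M (B \<inter> {\<omega> \<in> space M. \<forall>j\<in>J. case_prod X j \<omega> \<in> A j}) =
    (\<integral>\<^sup>+\<omega>. indicator B \<omega> * (\<Prod>j\<in>J. emeasure (measure_pmf (p (\<xi> (fst j) \<omega>))) (A j)) \<partial>M)"
proof -
  interpret F: finite_measure_subalgebra M "env_algebra M E \<xi>" by (rule env_finite_subalgebra)
  have BM[measurable]: "B \<in> sets M" using B subalgebra_env by (auto simp: subalgebra_def)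
  note [measurable] = env_measurable
  let ?C = "{\<omega> \<in> space M. \<forall>j\<in>J. case_prod X j \<omega> \<in> A j}"
  let ?g = "\<lambda>\<omega>. \<Prod>j\<in>J. measure (measure_pmf (p (\<xi> (fst j) \<omega>))) (A j)"
  have [measurable]: "case_prod X j \<in> measurable M (count_space UNIV)" if "j \<in> J" for j
    using that J by (auto intro!: measurable_offspring_number)
  have C[measurable]: "?C \<in> sets M" using J by measurable
  have ic: "integrable M (indicator ?C :: _ \<Rightarrow> real)" by (auto simp: less_top[symmetric])
  have ig: "integrable M (\<lambda>\<omega>. indicator B \<omega> * ?g \<omega>)"
    by (rule integrable_const_bound[where B=1]) (auto simp: indicator_def prod_nonneg intro!: prod_le_1)
  have "AE \<omega> in M. \<forall>j\<in>J. prob_given M (env_algebra M E \<xi>) {\<omega> \<in> space M. case_prod X j \<omega> \<in> A j} \<omega> =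
      measure (measure_pmf (p (\<xi> (fst j) \<omega>))) (A j)"
  proof (intro AE_finite_allI J(1))
    fix j assume "j \<in> J"
    then obtain n i where "j = (n, i)" "1 \<le> i" using J by auto
    then show "AE \<omega> in M. prob_given M (env_algebra M E \<xi>) {\<omega> \<in> space M. case_prod X j \<omega> \<in> A j} \<omega> =
        measure (measure_pmf (p (\<xi> (fst j) \<omega>))) (A j)"
      using prob_given_offspring[of i n "A j"] by simp
  qed
  moreover have "AE \<omega> in M. prob_given M (env_algebra M E \<xi>) ?C \<omega> =
      (\<Prod>j\<in>J. prob_given M (env_algebra M E \<xi>) {\<omega> \<in> space M. case_prod X j \<omega> \<in> A j} \<omega>)"
    using offspring_cond_indep J unfolding cond_indep_vars_def by auto
  ultimately have AE: "AE \<omega> in M. real_cond_exp M (env_algebra M E \<xi>) (indicator ?C) \<omega> = ?g \<omega>"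
    by eventually_elim (simp add: prob_given_def)
  have "measure M (B \<inter> ?C) = (\<integral>\<omega>\<in>B. indicator ?C \<omega> \<partial>M)"
    by (simp add: set_lebesgue_integral_def flip: indicator_inter_arith)
  also have "\<dots> = (\<integral>\<omega>\<in>B. real_cond_exp M (env_algebra M E \<xi>) (indicator ?C) \<omega> \<partial>M)"
    by (rule F.real_cond_exp_intA[OF ic B])
  also have "\<dots> = (\<integral>\<omega>\<in>B. ?g \<omega> \<partial>M)"
    using AE by (intro set_lebesgue_integral_cong_AE) auto
  finally have "emeasure M (B \<inter> ?C) = ennreal (\<integral>\<omega>. indicator B \<omega> * ?g \<omega> \<partial>M)"
    by (simp add: emeasure_eq_measure set_lebesgue_integral_def)
  also have "\<dots> = (\<integral>\<^sup>+\<omega>. ennreal (indicator B \<omega> * ?g \<omega>) \<partial>M)"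
    by (rule nn_integral_eq_integral[OF ig, symmetric]) (simp add: prod_nonneg)
  finally show ?thesis
    by (simp add: ennreal_mult'' prod_nonneg ennreal_indicator prod_ennreal measure_pmf.emeasure_eq_measure)
qed

lemma measurable_quenched_law[measurable]:
  "(\<lambda>\<omega>. distr (offspring_kernel p (env \<omega>)) (env_space \<Otimes>\<^sub>M offspring_space) (Pair (env \<omega>)))
    \<in> measurable M (subprob_algebra (env_space \<Otimes>\<^sub>M offspring_space))"
  by (rule measurable_distr2[where M=offspring_space]) measurable

text \<open>Both sides are finite measures that agree on products of an environment event and an
  offspring cylinder, an intersection-stable generator. Because the kernel is explicit, the
  disintegration holds over an arbitrary measurable space \<open>E\<close>.\<close>

lemma joint_law:
  "distr M (env_space \<Otimes>\<^sub>M offspring_space) (\<lambda>\<omega>. (env \<omega>, offspring \<omega>)) =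
    M \<bind> (\<lambda>\<omega>. distr (offspring_kernel p (env \<omega>)) (env_space \<Otimes>\<^sub>M offspring_space) (Pair (env \<omega>)))"
    (is "?L = ?R")
proof -
  let ?I = "(UNIV :: nat set) \<times> {1::nat..}" and ?c = "\<lambda>_. count_space UNIV :: nat measure"
  let ?G = "{a \<times> b |a b. a \<in> sets env_space \<and> b \<in> prod_algebra ?I ?c}"
  let ?\<Omega> = "space env_space \<times> space offspring_space"
  \<comment> \<open>The generator must contain the whole space; it is the unconstrained cylinder
    over the arbitrarily chosen index \<open>(0, 1)\<close>.\<close>
  have full: "space offspring_space \<in> prod_algebra ?I ?c"
  proof -
    have "space offspring_space = prod_emb ?I ?c {(0, 1)} (Pi\<^sub>E {(0, 1)} (\<lambda>_. UNIV))"
      by (auto simp: offspring_space_def space_PiM prod_emb_def)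
    then show ?thesis by (auto intro!: prod_algebraI)
  qed
  have "sets (env_space \<Otimes>\<^sub>M offspring_space) = sets (sigma ?\<Omega> ?G)"
  proof (rule sets_pair_eq[where Ca="{space env_space}" and Cb="{space offspring_space}"])
    show "sets env_space = sigma_sets (space env_space) (sets env_space)"
      by (simp only: sets.sigma_sets_eq)
    show "prod_algebra ?I ?c \<subseteq> Pow (space offspring_space)"
      "sets offspring_space = sigma_sets (space offspring_space) (prod_algebra ?I ?c)"
      using prod_algebra_sets_into_space[of ?I ?c] sets_PiM[of ?I ?c]
      by (simp_all add: offspring_space_def space_PiM)
  qed (use full sets.space_closed[of env_space] sets.top[of env_space] in simp_all)
  moreover have G: "?G \<subseteq> Pow ?\<Omega>"
    using prod_algebra_sets_into_space[of ?I ?c] sets.sets_into_space[of _ env_space]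
    by (fastforce simp: offspring_space_def space_PiM)
  ultimately have gen: "sets (env_space \<Otimes>\<^sub>M offspring_space) = sigma_sets ?\<Omega> ?G"
    by (simp add: sets_measure_of)
  have pair: "(\<lambda>\<omega>. (env \<omega>, offspring \<omega>)) \<in> measurable M (env_space \<Otimes>\<^sub>M offspring_space)"
    by measurable
  show ?thesis
  proof (rule measure_eqI_generator_eq[where E="?G" and \<Omega>="?\<Omega>" and A="\<lambda>_. ?\<Omega>"])
    show "Int_stable ?G"
    proof (rule Int_stableI)
      fix U V assume "U \<in> ?G" "V \<in> ?G"
      then obtain a b a' b' where UV: "U = a \<times> b" "V = a' \<times> b'"
        and ab: "a \<in> sets env_space" "a' \<in> sets env_space" "b \<in> prod_algebra ?I ?c" "b' \<in> prod_algebra ?I ?c"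
        by blast
      have "b \<inter> b' \<in> prod_algebra ?I ?c"
        using Int_stable_prod_algebra[of ?I ?c] ab unfolding Int_stable_def by blast
      moreover have "a \<inter> a' \<in> sets env_space" using ab by (intro sets.Int)
      ultimately show "U \<inter> V \<in> ?G" unfolding UV Times_Int_Times by blast
    qed
    show "?G \<subseteq> Pow ?\<Omega>" by (rule G)
    show "sets ?L = sigma_sets ?\<Omega> ?G" by (simp add: gen)
    show "sets ?R = sigma_sets ?\<Omega> ?G"
      unfolding gen[symmetric] by (rule sets_bind) (auto simp: not_empty)
    show "range (\<lambda>_. ?\<Omega>) \<subseteq> ?G" using full by blast
    show "emeasure ?L ?\<Omega> \<noteq> \<infinity>"
      using finite_measure.emeasure_finite[OF prob_space.finite_measure[OF prob_space_distr[OF pair]]]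
      by (simp only: infinity_ennreal_def not_False_eq_True)
    fix U assume "U \<in> ?G"
    then obtain a b where U: "U = a \<times> b" and a[measurable]: "a \<in> sets env_space" and b: "b \<in> prod_algebra ?I ?c"
      by blast
    from b obtain J F where b': "b = prod_emb ?I ?c J (Pi\<^sub>E J F)" and J: "finite J" "J \<subseteq> ?I"
      by (rule prod_algebraE)
    have bs[measurable]: "b \<in> sets offspring_space"
      using b unfolding offspring_space_def sets_PiM by blast
    define B where "B = env -` a \<inter> space M"
    have B: "B \<in> sets (env_algebra M E \<xi>)"
      unfolding env_algebra_def B_def by (rule in_vimage_algebra[OF a])
    have "emeasure ?L U = emeasure M ((\<lambda>\<omega>. (env \<omega>, offspring \<omega>)) -` U \<inter> space M)"
      unfolding U by (rule emeasure_distr) measurable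
    also have "(\<lambda>\<omega>. (env \<omega>, offspring \<omega>)) -` U \<inter> space M =
        B \<inter> {\<omega> \<in> space M. \<forall>j\<in>J. case_prod X j \<omega> \<in> F j}"
    proof -
      have "offspring \<omega> \<in> b \<longleftrightarrow> (\<forall>j\<in>J. offspring \<omega> j \<in> F j)" for \<omega>
        unfolding b' prod_emb_def by (simp add: restrict_PiE_iff Pi_iff del: restrict_apply restrict_restrict)
      moreover have "offspring \<omega> j = case_prod X j \<omega>" if "j \<in> J" for \<omega> j
        using that J by (simp add: subsetD)
      ultimately show ?thesis by (auto simp: U B_def)
    qed
    also have "emeasure M \<dots> = (\<integral>\<^sup>+\<omega>. indicator B \<omega> * (\<Prod>j\<in>J. emeasure (measure_pmf (p (\<xi> (fst j) \<omega>))) (F j)) \<partial>M)"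
      by (rule emeasure_env_offspring_cylinder[OF B J])
    also have "\<dots> = (\<integral>\<^sup>+\<omega>. emeasure (distr (offspring_kernel p (env \<omega>)) (env_space \<Otimes>\<^sub>M offspring_space) (Pair (env \<omega>))) U \<partial>M)"
    proof (rule nn_integral_cong)
      fix \<omega> assume \<omega>: "\<omega> \<in> space M"
      then have e: "env \<omega> \<in> space env_space" by (rule measurable_space[OF measurable_env])
      have "Pair (env \<omega>) \<in> measurable (offspring_kernel p (env \<omega>)) (env_space \<Otimes>\<^sub>M offspring_space)"
        using e by (simp add: measurable_cong_sets[OF sets_offspring_kernel refl])
      then have "emeasure (distr (offspring_kernel p (env \<omega>)) (env_space \<Otimes>\<^sub>M offspring_space) (Pair (env \<omega>))) U =
          emeasure (offspring_kernel p (env \<omega>)) (Pair (env \<omega>) -` U \<inter> space (offspring_kernel p (env \<omega>)))"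
        unfolding U by (rule emeasure_distr) measurable
      also have "Pair (env \<omega>) -` U \<inter> space (offspring_kernel p (env \<omega>)) = (if \<omega> \<in> B then b else {})"
        using \<omega> sets.sets_into_space[OF bs] sets_eq_imp_space_eq[OF sets_offspring_kernel, of p "env \<omega>"]
        by (auto simp: U B_def)
      also have "emeasure (offspring_kernel p (env \<omega>)) \<dots> = indicator B \<omega> * (\<Prod>j\<in>J. emeasure (measure_pmf (p (\<xi> (fst j) \<omega>))) (F j))"
        using emeasure_offspring_kernel[OF J, of p "env \<omega>" F] by (simp add: b')
      finally show "indicator B \<omega> * (\<Prod>j\<in>J. emeasure (measure_pmf (p (\<xi> (fst j) \<omega>))) (F j)) =
          emeasure (distr (offspring_kernel p (env \<omega>)) (env_space \<Otimes>\<^sub>M offspring_space) (Pair (env \<omega>))) U" by simp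
    qed
    also have "\<dots> = emeasure ?R U"
      unfolding U by (rule emeasure_bind[OF not_empty measurable_quenched_law, symmetric]) measurable
    finally show "emeasure ?L U = emeasure ?R U" .
  qed auto
qed

section \<open>Quenched and annealed estimates\<close>

lemma borel_measurable_offspring_mean: "(\<lambda>e. offspring_mean (p e)) \<in> borel_measurable E"
  unfolding offspring_mean_def using offspring_measurable by measurable

text \<open>Under the path law the shift is measure preserving and ergodic, and \<open>f\<close> has
  positive mean. The Birkhoff sums of \<open>f\<close> along the environment are
  \<open>ln (bp_Pi \<xi> p n \<omega>) - r * n\<close>, so a random lower bound for them
  exponentiates to the claim.\<close>

lemma AE_bp_Pi_exponential_growth:
  assumes int: "integrable M (\<lambda>\<omega>. ln (bp_m \<xi> p 0 \<omega>))"
    and r: "r < (\<integral>\<omega>. ln (bp_m \<xi> p 0 \<omega>) \<partial>M)"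
  shows "AE \<omega> in M. \<exists>C>0. \<forall>n. C * exp (r * real n) \<le> bp_Pi \<xi> p n \<omega>"
proof -
  let ?\<mu> = "path_law M E \<xi>"
  define f where "f x = ln (offspring_mean (p (x 0))) - r" for x :: "nat \<Rightarrow> 'e"
  let ?T = "\<lambda>(x :: nat \<Rightarrow> 'e) n. x (Suc n)"
  have T[measurable]: "?T \<in> measurable env_space env_space"
    by (intro measurable_PiM_single') (auto simp: space_PiM)
  note [measurable] = borel_measurable_offspring_mean
  have f[measurable]: "f \<in> borel_measurable env_space" unfolding f_def by measurable
  interpret \<mu>: prob_space ?\<mu> unfolding path_law_def by (rule prob_space_distr) (rule measurable_env)
  have sets: "sets ?\<mu> = sets env_space" by (simp add: path_law_def)
  have funpow: "(?T ^^ i) x = (\<lambda>n. x (n + i))" for i x by (induction i) auto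
  have "AE x in ?\<mu>. \<exists>C. \<forall>n. C \<le> (\<Sum>i<n. f ((?T ^^ i) x))"
  proof (rule \<mu>.AE_ergodic_sums_bounded_below)
    show "?T \<in> measurable ?\<mu> ?\<mu>" using T by (simp add: measurable_cong_sets[OF sets sets])
    have "distr ?\<mu> ?\<mu> ?T = distr (distr M env_space env) env_space ?T"
      by (intro distr_cong) (auto simp: path_law_def)
    also have "\<dots> = path_law M E (\<lambda>n. \<xi> (n + 1))"
      by (subst distr_distr[OF T measurable_env]) (simp add: path_law_def comp_def)
    also have "\<dots> = ?\<mu>" using env_stationary unfolding stationary_seq_def by blast
    finally show "distr ?\<mu> ?\<mu> ?T = ?\<mu>" .
    show "measure ?\<mu> A \<in> {0, 1}" if "A \<in> sets ?\<mu>" "?T -` A \<inter> space ?\<mu> = A" for A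
      using env_ergodic that sets_eq_imp_space_eq[OF sets] sets unfolding ergodic_seq_def by auto
    have "integrable M (\<lambda>\<omega>. f (env \<omega>))" using int by (simp add: f_def bp_m_def)
    then show "integrable ?\<mu> f" unfolding path_law_def by (simp add: integrable_distr_eq)
    have "integral\<^sup>L ?\<mu> f = (\<integral>\<omega>. ln (bp_m \<xi> p 0 \<omega>) - r \<partial>M)"
      unfolding path_law_def by (subst integral_distr) (auto simp: f_def bp_m_def)
    then show "0 < integral\<^sup>L ?\<mu> f" using int r by (simp add: prob_space)
  qed
  then have "AE \<omega> in M. \<exists>C. \<forall>n. C \<le> (\<Sum>i<n. f ((?T ^^ i) (env \<omega>)))"
    unfolding path_law_def by (rule AE_distrD[OF measurable_env])
  then show ?thesis
  proof (rule AE_mp, intro AE_I2 impI)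
    fix \<omega> assume \<omega>: "\<omega> \<in> space M" and "\<exists>C. \<forall>n. C \<le> (\<Sum>i<n. f ((?T ^^ i) (env \<omega>)))"
    then obtain C where C: "\<And>n. C \<le> (\<Sum>i<n. ln (bp_m \<xi> p i \<omega>) - r)"
      by (auto simp: funpow f_def bp_m_def)
    have pos: "0 < bp_m \<xi> p i \<omega>" for i unfolding bp_m_def by (rule offspring_mean_pos[OF \<omega>])
    have "exp C * exp (r * real n) \<le> bp_Pi \<xi> p n \<omega>" for n
    proof -
      have "C + r * real n \<le> (\<Sum>i<n. ln (bp_m \<xi> p i \<omega>))"
        using C[of n] by (simp add: sum_subtractf mult.commute)
      then have "exp C * exp (r * real n) \<le> exp (\<Sum>i<n. ln (bp_m \<xi> p i \<omega>))" by (simp flip: exp_add)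
      also have "\<dots> = bp_Pi \<xi> p n \<omega>" using pos by (simp add: bp_Pi_def exp_sum)
      finally show ?thesis .
    qed
    then show "\<exists>C>0. \<forall>n. C * exp (r * real n) \<le> bp_Pi \<xi> p n \<omega>" by (intro exI[of _ "exp C"]) auto
  qed
qed

section \<open>Transfer between quenched and annealed statements\<close>

text \<open>By \<open>joint_law\<close> the pair of environment and offspring family has the mixture
  of the quenched laws as its law, so a property that is almost sure under almost every quenched law
  is almost sure under \<open>M\<close>.\<close>

lemma AE_quenched:
  assumes P[measurable]: "Measurable.pred (env_space \<Otimes>\<^sub>M offspring_space) P"
    and AE: "AE \<omega> in M. AE f in offspring_kernel p (env \<omega>). P (env \<omega>, f)"
  shows "AE \<omega> in M. P (env \<omega>, offspring \<omega>)"
proof -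
  have pair: "(\<lambda>\<omega>. (env \<omega>, offspring \<omega>)) \<in> measurable M (env_space \<Otimes>\<^sub>M offspring_space)"
    by measurable
  have "AE \<omega> in M. AE z in distr (offspring_kernel p (env \<omega>)) (env_space \<Otimes>\<^sub>M offspring_space) (Pair (env \<omega>)). P z"
    using AE AE_space
  proof eventually_elim
    case (elim \<omega>)
    then have e: "env \<omega> \<in> space env_space" by (auto intro: measurable_space[OF measurable_env])
    have "Pair (env \<omega>) \<in> measurable (offspring_kernel p (env \<omega>)) (env_space \<Otimes>\<^sub>M offspring_space)"
      using e by (simp add: measurable_cong_sets[OF sets_offspring_kernel refl])
    then show ?case
      using elim P by (subst AE_distr_iff) (auto simp: pred_def)
  qed
  then have "AE z in M \<bind> (\<lambda>\<omega>. distr (offspring_kernel p (env \<omega>)) (env_space \<Otimes>\<^sub>M offspring_space) (Pair (env \<omega>))). P z"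
    by (subst AE_bind[OF measurable_quenched_law P])
  then show ?thesis unfolding joint_law[symmetric] by (rule AE_distrD[OF pair])
qed

text \<open>As \<open>X 0 1\<close> is the size of generation 1, this turns the moment hypothesis on
  \<open>bp_Z X 1\<close> into one on the offspring law \<open>p (\<xi> 0 \<omega>)\<close>.\<close>

lemma nn_integral_first_offspring:
  assumes g: "\<And>k. (\<lambda>e. g e k) \<in> borel_measurable E"
  shows "(\<integral>\<^sup>+\<omega>. g (\<xi> 0 \<omega>) (X 0 1 \<omega>) \<partial>M) = (\<integral>\<^sup>+\<omega>. \<integral>\<^sup>+k. g (\<xi> 0 \<omega>) k \<partial>measure_pmf (p (\<xi> 0 \<omega>)) \<partial>M)"
proof -
  let ?h = "\<lambda>z :: (nat \<Rightarrow> 'e) \<times> (nat \<times> nat \<Rightarrow> nat). g (fst z 0) (snd z (0, 1))"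
  note [measurable] = g
  have c[measurable]: "(\<lambda>f. f (0, 1)) \<in> measurable offspring_space (count_space UNIV)"
    unfolding offspring_space_def by (rule measurable_component_singleton) simp
  have h[measurable]: "?h \<in> borel_measurable (env_space \<Otimes>\<^sub>M offspring_space)"
    by (rule measurable_compose_countable[where f="\<lambda>k z. g (fst z 0) k" and g="\<lambda>z. snd z (0, 1)"]) measurable
  have "(\<integral>\<^sup>+\<omega>. g (\<xi> 0 \<omega>) (X 0 1 \<omega>) \<partial>M) =
      (\<integral>\<^sup>+z. ?h z \<partial>distr M (env_space \<Otimes>\<^sub>M offspring_space) (\<lambda>\<omega>. (env \<omega>, offspring \<omega>)))"
  proof (subst nn_integral_distr)
    show "(\<lambda>\<omega>. (env \<omega>, offspring \<omega>)) \<in> measurable M (env_space \<Otimes>\<^sub>M offspring_space)" by measurable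
  qed (use h in simp_all)
  also have "\<dots> = (\<integral>\<^sup>+\<omega>. \<integral>\<^sup>+z. ?h z \<partial>distr (offspring_kernel p (env \<omega>)) (env_space \<Otimes>\<^sub>M offspring_space) (Pair (env \<omega>)) \<partial>M)"
    unfolding joint_law by (rule nn_integral_bind[OF h measurable_quenched_law])
  also have "\<dots> = (\<integral>\<^sup>+\<omega>. \<integral>\<^sup>+k. g (\<xi> 0 \<omega>) k \<partial>measure_pmf (p (\<xi> 0 \<omega>)) \<partial>M)"
  proof (rule nn_integral_cong)
    fix \<omega> assume "\<omega> \<in> space M"
    then have e: "env \<omega> \<in> space env_space" by (rule measurable_space[OF measurable_env])
    have "Pair (env \<omega>) \<in> measurable (offspring_kernel p (env \<omega>)) (env_space \<Otimes>\<^sub>M offspring_space)"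
      using e by (simp add: measurable_cong_sets[OF sets_offspring_kernel refl])
    then have "(\<integral>\<^sup>+z. ?h z \<partial>distr (offspring_kernel p (env \<omega>)) (env_space \<Otimes>\<^sub>M offspring_space) (Pair (env \<omega>))) =
        (\<integral>\<^sup>+f. g (\<xi> 0 \<omega>) (f (0, 1)) \<partial>offspring_kernel p (env \<omega>))"
      using h by (subst nn_integral_distr) auto
    also have "\<dots> = (\<integral>\<^sup>+k. g (\<xi> 0 \<omega>) k \<partial>distr (offspring_kernel p (env \<omega>)) (count_space UNIV) (\<lambda>f. f (0, 1)))"
      using c by (subst nn_integral_distr) (simp_all add: measurable_cong_sets[OF sets_offspring_kernel refl])
    finally show "(\<integral>\<^sup>+z. ?h z \<partial>distr (offspring_kernel p (env \<omega>)) (env_space \<Otimes>\<^sub>M offspring_space) (Pair (env \<omega>))) =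
        (\<integral>\<^sup>+k. g (\<xi> 0 \<omega>) k \<partial>measure_pmf (p (\<xi> 0 \<omega>)))"
      by (simp add: distr_offspring_kernel)
  qed
  finally show ?thesis .
qed

lemma nn_integral_env_stationary:
  assumes g[measurable]: "g \<in> borel_measurable E"
  shows "(\<integral>\<^sup>+\<omega>. g (\<xi> n \<omega>) \<partial>M) = (\<integral>\<^sup>+\<omega>. g (\<xi> 0 \<omega>) \<partial>M)"
proof -
  have m: "(\<lambda>\<omega> k. \<xi> (k + n) \<omega>) \<in> measurable M env_space" for n
    by (intro measurable_PiM_single') (auto intro: env_measurable measurable_space[OF env_measurable])
  have "(\<integral>\<^sup>+\<omega>. g (\<xi> n \<omega>) \<partial>M) = (\<integral>\<^sup>+x. g (x 0) \<partial>path_law M E (\<lambda>k. \<xi> (k + n)))" for n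
    unfolding path_law_def using m by (subst nn_integral_distr) auto
  moreover have "path_law M E (\<lambda>k. \<xi> (k + n)) = path_law M E (\<lambda>k. \<xi> (k + 0))" for n
    using env_stationary unfolding stationary_seq_def by simp
  ultimately show ?thesis by metis
qed

text \<open>The series has finite expectation. Stationarity moves every summand to
  \<open>\<xi> 0\<close> while its level \<open>exp (a * n)\<close> stays; the sum over
  \<open>n\<close> can then be carried out for each fixed offspring number, at the price of the
  factor \<open>(log_plus y / a) powr (1 + \<alpha>)\<close>.\<close>

lemma AE_weighted_mean_excess_finite:
  assumes a: "0 < a" and \<alpha>: "0 < \<alpha>"
    and int: "integrable M (\<lambda>\<omega>. real (bp_Z X 1 \<omega>) / bp_m \<xi> p 0 \<omega> *
           log_plus (real (bp_Z X 1 \<omega>) / bp_m \<xi> p 0 \<omega>) powr (1 + \<alpha>))"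
  shows "AE \<omega> in M. (\<Sum>n. ennreal (real n powr \<alpha> * mean_excess (p (\<xi> n \<omega>)) (exp (a * real n)))) < \<infinity>"
proof -
  let ?m = "\<lambda>e. offspring_mean (p e)"
  define x where "x n e = (\<integral>\<^sup>+k. ennreal (real k / ?m e * indicator {k. exp (a * real n) < real k / ?m e} k)
    \<partial>measure_pmf (p e))" for n e
  define \<phi> where "\<phi> e k = ennreal (real k / ?m e * log_plus (real k / ?m e) powr (1 + \<alpha>))" for e k
  \<comment> \<open>The factor that comes from pulling \<open>1 / a\<close> out of
    \<open>(log_plus y / a) powr (1 + \<alpha>)\<close>.\<close>
  define c where "c = (1 / a) powr (1 + \<alpha>)"
  note [measurable] = borel_measurable_offspring_mean offspring_measurable env_measurable
  have x[measurable]: "x n \<in> borel_measurable E" for n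
    unfolding x_def[abs_def] nn_integral_pmf_nat indicator_def by measurable
  have \<phi>[measurable]: "(\<lambda>e. \<phi> e k) \<in> borel_measurable E" for k
    unfolding \<phi>_def log_plus_def by measurable
  have ex: "ennreal (real n powr \<alpha> * mean_excess (p (\<xi> n \<omega>)) (exp (a * real n))) =
      ennreal (real n powr \<alpha>) * x n (\<xi> n \<omega>)" if "\<omega> \<in> space M" for n \<omega>
    unfolding x_def
    by (subst ennreal_mean_excess[symmetric])
       (auto simp: ennreal_mult' offspring_mean_finite[OF that] offspring_mean_pos[OF that])
  have bd: "(\<Sum>n. ennreal (real n powr \<alpha>) * x n (\<xi> 0 \<omega>)) \<le> ennreal c * (\<integral>\<^sup>+k. \<phi> (\<xi> 0 \<omega>) k \<partial>measure_pmf (p (\<xi> 0 \<omega>)))"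
    if "\<omega> \<in> space M" for \<omega>
  proof -
    define m where "m = ?m (\<xi> 0 \<omega>)"
    have m: "0 < m" unfolding m_def by (rule offspring_mean_pos[OF that])
    let ?q = "measure_pmf (p (\<xi> 0 \<omega>))"
    have "(\<Sum>n. ennreal (real n powr \<alpha>) * x n (\<xi> 0 \<omega>)) =
        (\<Sum>n. \<integral>\<^sup>+k. ennreal (real k / m) * ennreal (real n powr \<alpha> * indicator {y. exp (a * real n) < y} (real k / m)) \<partial>?q)"
      unfolding x_def m_def[symmetric] using m
      by (subst nn_integral_cmult[symmetric])
         (auto simp: ennreal_mult'[symmetric] indicator_def intro!: suminf_cong nn_integral_cong)
    also have "\<dots> = (\<integral>\<^sup>+k. (\<Sum>n. ennreal (real k / m) * ennreal (real n powr \<alpha> * indicator {y. exp (a * real n) < y} (real k / m))) \<partial>?q)"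
      by (rule nn_integral_suminf[symmetric]) simp
    also have "\<dots> = (\<integral>\<^sup>+k. ennreal (real k / m) * (\<Sum>n. ennreal (real n powr \<alpha> * indicator {y. exp (a * real n) < y} (real k / m))) \<partial>?q)"
      by (simp only: ennreal_suminf_cmult)
    also have "\<dots> \<le> (\<integral>\<^sup>+k. ennreal (real k / m) * ennreal ((log_plus (real k / m) / a) powr (1 + \<alpha>)) \<partial>?q)"
      by (intro nn_integral_mono mult_left_mono suminf_powr_indicator_exp_le a \<alpha>) simp
    also have "\<dots> = (\<integral>\<^sup>+k. ennreal c * \<phi> (\<xi> 0 \<omega>) k \<partial>?q)"
    proof (intro nn_integral_cong)
      fix k
      have lp: "0 \<le> log_plus y" for y by (simp add: log_plus_def)
      have "(log_plus (real k / m) / a) powr (1 + \<alpha>) = c * log_plus (real k / m) powr (1 + \<alpha>)"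
        using powr_mult[of "1 / a" "log_plus (real k / m)" "1 + \<alpha>"] lp[of "real k / m"] a
        by (simp add: c_def)
      then show "ennreal (real k / m) * ennreal ((log_plus (real k / m) / a) powr (1 + \<alpha>)) = ennreal c * \<phi> (\<xi> 0 \<omega>) k"
        using m by (simp add: \<phi>_def m_def[symmetric] ennreal_mult'[symmetric] c_def mult_ac)
    qed
    also have "\<dots> = ennreal c * (\<integral>\<^sup>+k. \<phi> (\<xi> 0 \<omega>) k \<partial>?q)" by (rule nn_integral_cmult) simp
    finally show ?thesis .
  qed
  have [measurable]: "(\<lambda>\<omega>. \<integral>\<^sup>+k. \<phi> (\<xi> 0 \<omega>) k \<partial>measure_pmf (p (\<xi> 0 \<omega>))) \<in> borel_measurable M"
    unfolding nn_integral_pmf_nat by measurable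
  have "(\<integral>\<^sup>+\<omega>. (\<Sum>n. ennreal (real n powr \<alpha>) * x n (\<xi> n \<omega>)) \<partial>M) =
      (\<Sum>n. ennreal (real n powr \<alpha>) * (\<integral>\<^sup>+\<omega>. x n (\<xi> n \<omega>) \<partial>M))"
    by (simp add: nn_integral_suminf nn_integral_cmult)
  also have "\<dots> = (\<Sum>n. ennreal (real n powr \<alpha>) * (\<integral>\<^sup>+\<omega>. x n (\<xi> 0 \<omega>) \<partial>M))"
    by (subst nn_integral_env_stationary) simp_all
  also have "\<dots> = (\<integral>\<^sup>+\<omega>. (\<Sum>n. ennreal (real n powr \<alpha>) * x n (\<xi> 0 \<omega>)) \<partial>M)"
    by (simp add: nn_integral_suminf nn_integral_cmult)
  also have "\<dots> \<le> (\<integral>\<^sup>+\<omega>. ennreal c * (\<integral>\<^sup>+k. \<phi> (\<xi> 0 \<omega>) k \<partial>measure_pmf (p (\<xi> 0 \<omega>))) \<partial>M)"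
    by (intro nn_integral_mono bd)
  also have "\<dots> = ennreal c * (\<integral>\<^sup>+\<omega>. \<phi> (\<xi> 0 \<omega>) (X 0 1 \<omega>) \<partial>M)"
    by (subst nn_integral_first_offspring[of \<phi>, OF \<phi>]) (rule nn_integral_cmult, measurable)
  also have "\<dots> < \<infinity>"
  proof -
    have "(\<integral>\<^sup>+\<omega>. \<phi> (\<xi> 0 \<omega>) (X 0 1 \<omega>) \<partial>M) =
        (\<integral>\<^sup>+\<omega>. ennreal (real (bp_Z X 1 \<omega>) / bp_m \<xi> p 0 \<omega> *
           log_plus (real (bp_Z X 1 \<omega>) / bp_m \<xi> p 0 \<omega>) powr (1 + \<alpha>)) \<partial>M)"
      by (simp add: \<phi>_def bp_m_def)
    also have "\<dots> < \<infinity>"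
      using int offspring_mean_pos[of _ 0]
      by (subst nn_integral_eq_integral) (auto simp: bp_m_def less_imp_le)
    finally show ?thesis by (simp add: ennreal_mult_less_top)
  qed
  finally have "AE \<omega> in M. (\<Sum>n. ennreal (real n powr \<alpha>) * x n (\<xi> n \<omega>)) \<noteq> \<infinity>"
    by (intro nn_integral_PInf_AE) auto
  then show ?thesis
    by (rule AE_mp) (intro AE_I2 impI, simp add: ex less_top)
qed

text \<open>For almost every environment the quenched expectation of the whole weighted series is
  finite, so the series converges almost surely under the quenched law; \<open>AE_quenched\<close>
  carries this back to \<open>M\<close>.\<close>

lemma AE_weighted_increments_summable:
  assumes int: "integrable M (\<lambda>\<omega>. ln (bp_m \<xi> p 0 \<omega>))"
    and pos: "0 < (\<integral>\<omega>. ln (bp_m \<xi> p 0 \<omega>) \<partial>M)" and \<alpha>: "0 < \<alpha>"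
    and int': "integrable M (\<lambda>\<omega>. real (bp_Z X 1 \<omega>) / bp_m \<xi> p 0 \<omega> *
           log_plus (real (bp_Z X 1 \<omega>) / bp_m \<xi> p 0 \<omega>) powr (1 + \<alpha>))"
  shows "AE \<omega> in M. summable (\<lambda>n. real n powr \<alpha> * \<bar>bp_W \<xi> p X (Suc n) \<omega> - bp_W \<xi> p X n \<omega>\<bar>)"
proof -
  \<comment> \<open>The rate \<open>2 * a\<close> lies strictly below the mean of
    \<open>ln (bp_m \<xi> p 0 \<omega>)\<close>, so it is admissible for the growth of
    \<open>bp_Pi\<close>; the truncation level \<open>exp (a * n)\<close> grows more slowly, which
    leaves the ratio a decay of order \<open>exp (- a * n)\<close>.\<close>
  define a where "a = (\<integral>\<omega>. ln (bp_m \<xi> p 0 \<omega>) \<partial>M) / 4"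
  have a: "0 < a" "2 * a < (\<integral>\<omega>. ln (bp_m \<xi> p 0 \<omega>) \<partial>M)" using pos by (auto simp: a_def)
  let ?C = "\<lambda>k i (f :: nat \<times> nat \<Rightarrow> nat). f (k, i)"
  define P where "P x n = (\<Prod>k<n. offspring_mean (p (x k)))" for x :: "nat \<Rightarrow> 'e" and n
  \<comment> \<open>The weighted increment as a function of environment and offspring family, so
    that one measurable function on the product space serves both the quenched laws and
    \<open>M\<close>.\<close>
  define D where "D n x f = ennreal (real n powr \<alpha>) *
    ennreal \<bar>real (bp_Z ?C (Suc n) f) / P x (Suc n) - real (bp_Z ?C n f) / P x n\<bar>" for n x f
  note [measurable] = borel_measurable_offspring_mean
  have Z[measurable]: "bp_Z ?C n \<in> measurable offspring_space (count_space UNIV)" for n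
    unfolding offspring_space_def by (intro measurable_bp_Z measurable_component_singleton) auto
  have [measurable]: "(\<lambda>x. P x n) \<in> borel_measurable env_space" for n
    unfolding P_def by measurable
  have D[measurable]: "case_prod (D n) \<in> borel_measurable (env_space \<Otimes>\<^sub>M offspring_space)" for n
    unfolding D_def case_prod_beta' by measurable
  have "AE \<omega> in M. AE f in offspring_kernel p (env \<omega>). (\<Sum>n. D n (env \<omega>) f) \<noteq> \<infinity>"
    using AE_bp_Pi_exponential_growth[OF int a(2)] AE_weighted_mean_excess_finite[OF a(1) \<alpha> int'] AE_space
  proof eventually_elim
    case (elim \<omega>)
    from elim(1) obtain C where C: "0 < C" "\<And>n. C * exp (2 * a * real n) \<le> bp_Pi \<xi> p n \<omega>" by blast
    note \<omega> = elim(3)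
    let ?K = "offspring_kernel p (env \<omega>)"
    interpret K: prob_space ?K by (rule prob_space_offspring_kernel)
    have e: "env \<omega> \<in> space env_space" by (rule measurable_space[OF measurable_env \<omega>])
    have DK[measurable]: "D n (env \<omega>) \<in> borel_measurable ?K" for n
      using measurable_Pair2[OF D[of n] e] by (simp add: measurable_cong_sets[OF sets_offspring_kernel refl])
    have ZK: "(\<lambda>f. real (bp_Z ?C n f)) \<in> borel_measurable ?K" for n
      using measurable_compose[OF Z[of n], of real borel] by (simp add: measurable_cong_sets[OF sets_offspring_kernel refl])
    have ex0: "0 \<le> mean_excess (p (\<xi> n \<omega>)) t" for n t
      unfolding mean_excess_def using offspring_mean_pos[OF \<omega>, of n] by (auto intro!: integral_nonneg)
    have le: "integral\<^sup>N ?K (D n (env \<omega>)) \<le> ennreal (1 / sqrt C * (real n powr \<alpha> * exp (- (a / 2) * real n))) +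
        2 * ennreal (real n powr \<alpha> * mean_excess (p (\<xi> n \<omega>)) (exp (a * real n)))" for n
    proof -
      let ?ex = "mean_excess (p (\<xi> n \<omega>)) (exp (a * real n))"
      have "integral\<^sup>N ?K (D n (env \<omega>)) = ennreal (real n powr \<alpha>) *
          (\<integral>\<^sup>+f. \<bar>real (bp_Z ?C (Suc n) f) / P (env \<omega>) (Suc n) - real (bp_Z ?C n f) / P (env \<omega>) n\<bar> \<partial>?K)"
        unfolding D_def
        by (intro nn_integral_cmult measurable_compose[OF _ measurable_ennreal] borel_measurable_abs
            borel_measurable_diff borel_measurable_divide ZK borel_measurable_const)
      also have "\<dots> \<le> ennreal (real n powr \<alpha>) * ennreal (sqrt (exp (a * real n) / P (env \<omega>) n) + 2 * ?ex)"
        unfolding P_def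
        by (intro mult_left_mono K.nn_integral_abs_increment_le indep_vars_offspring_kernel
              offspring_mean_finite[OF \<omega>] offspring_mean_pos[OF \<omega>])
           (auto simp: distr_offspring_kernel)
      also have "\<dots> \<le> ennreal (real n powr \<alpha>) * ennreal (1 / sqrt C * exp (- (a / 2) * real n) + 2 * ?ex)"
      proof (intro mult_left_mono ennreal_leI add_right_mono)
        have "C * exp (2 * a * real n) \<le> P (env \<omega>) n" using C(2)[of n] by (simp add: P_def bp_Pi_def bp_m_def)
        then have "exp (a * real n) / P (env \<omega>) n \<le> exp (a * real n) / (C * exp (2 * a * real n))"
          using C(1) by (intro divide_left_mono mult_pos_pos) (auto intro: less_le_trans[rotated])
        also have "\<dots> = (1 / sqrt C * exp (- (a / 2) * real n))\<^sup>2"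
          using C(1) by (simp add: power_mult_distrib power_divide exp_double[symmetric] exp_minus field_simps flip: exp_add)
        finally show "sqrt (exp (a * real n) / P (env \<omega>) n) \<le> 1 / sqrt C * exp (- (a / 2) * real n)"
          using C(1) by (intro real_le_lsqrt) auto
      qed simp
      also have "\<dots> = ennreal (1 / sqrt C * (real n powr \<alpha> * exp (- (a / 2) * real n)) + 2 * (real n powr \<alpha> * ?ex))"
        using C(1) ex0 by (subst ennreal_mult'[symmetric]) (auto simp: algebra_simps)
      also have "\<dots> = ennreal (1 / sqrt C * (real n powr \<alpha> * exp (- (a / 2) * real n))) + 2 * ennreal (real n powr \<alpha> * ?ex)"
        using C(1) ex0 by (subst ennreal_plus) (auto simp: ennreal_mult')
      finally show ?thesis .
    qed
    have "(\<integral>\<^sup>+f. (\<Sum>n. D n (env \<omega>) f) \<partial>?K) = (\<Sum>n. integral\<^sup>N ?K (D n (env \<omega>)))"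
      by (rule nn_integral_suminf) simp
    also have "\<dots> \<le> (\<Sum>n. ennreal (1 / sqrt C * (real n powr \<alpha> * exp (- (a / 2) * real n))) +
        2 * ennreal (real n powr \<alpha> * mean_excess (p (\<xi> n \<omega>)) (exp (a * real n))))"
      by (intro suminf_le le) auto
    also have "\<dots> = (\<Sum>n. ennreal (1 / sqrt C * (real n powr \<alpha> * exp (- (a / 2) * real n)))) +
        2 * (\<Sum>n. ennreal (real n powr \<alpha> * mean_excess (p (\<xi> n \<omega>)) (exp (a * real n))))"
      by (subst suminf_add[symmetric]) auto
    also have "\<dots> < \<infinity>"
    proof -
      have "summable (\<lambda>n. 1 / sqrt C * (real n powr \<alpha> * exp (- (a / 2) * real n)))"
        using a(1) by (intro summable_mult summable_powr_exp) simp
      then have "(\<Sum>n. ennreal (1 / sqrt C * (real n powr \<alpha> * exp (- (a / 2) * real n)))) < \<infinity>"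
        using C(1) by (subst suminf_ennreal2) auto
      then show ?thesis using elim(2) by (simp add: ennreal_mult_less_top)
    qed
    finally show ?case by (intro nn_integral_PInf_AE) auto
  qed
  then have "AE \<omega> in M. (\<lambda>z. (\<Sum>n. D n (fst z) (snd z)) \<noteq> \<infinity>) (env \<omega>, offspring \<omega>)"
    using D by (intro AE_quenched) (auto simp: case_prod_beta')
  then show ?thesis
  proof (rule AE_mp, intro AE_I2 impI)
    fix \<omega> assume "(\<Sum>n. D n (fst (env \<omega>, offspring \<omega>)) (snd (env \<omega>, offspring \<omega>))) \<noteq> \<infinity>"
    moreover have "bp_Z ?C n (offspring \<omega>) = bp_Z X n \<omega>" for n by (rule bp_Z_cong) auto
    moreover have "P (env \<omega>) n = bp_Pi \<xi> p n \<omega>" for n by (simp add: P_def bp_Pi_def bp_m_def)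
    ultimately have "(\<Sum>n. ennreal (real n powr \<alpha> * \<bar>bp_W \<xi> p X (Suc n) \<omega> - bp_W \<xi> p X n \<omega>\<bar>)) \<noteq> top"
      unfolding D_def by (simp add: bp_W_def ennreal_mult'' del: bp_Z.simps)
    then show "summable (\<lambda>n. real n powr \<alpha> * \<bar>bp_W \<xi> p X (Suc n) \<omega> - bp_W \<xi> p X n \<omega>\<bar>)"
      by (intro summable_suminf_not_top) auto
  qed
qed

end

theorem theorem1p2:
  fixes M :: "'a measure" and E :: "'e measure"
    and \<xi> :: "nat \<Rightarrow> 'a \<Rightarrow> 'e"
    and p :: "'e \<Rightarrow> nat pmf"
    and X :: "nat \<Rightarrow> nat \<Rightarrow> 'a \<Rightarrow> nat"
    and \<alpha> :: real
  assumes "branching_process_random_env M E \<xi> p X"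
    and "integrable M (\<lambda>\<omega>. ln (bp_m \<xi> p 0 \<omega>))"
    and "0 < (\<integral>\<omega>. ln (bp_m \<xi> p 0 \<omega>) \<partial>M)"
    and "0 < \<alpha>"
    and "integrable M (\<lambda>\<omega>. real (bp_Z X 1 \<omega>) / bp_m \<xi> p 0 \<omega> *
           log_plus (real (bp_Z X 1 \<omega>) / bp_m \<xi> p 0 \<omega>) powr (1 + \<alpha>))"
  shows "(AE \<omega> in M. (\<lambda>n. bp_W_lim \<xi> p X \<omega> - bp_W \<xi> p X n \<omega>) \<in> o(\<lambda>n. real n powr (- \<alpha>))) \<and>
    (1 \<le> \<alpha> \<longrightarrow> (AE \<omega> in M. summable (\<lambda>n. bp_W_lim \<xi> p X \<omega> - bp_W \<xi> p X n \<omega>)))"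
proof -
  interpret branching_process_random_env M E \<xi> p X by fact
  \<comment> \<open>At each point of this event the sequence
    \<open>bp_W \<xi> p X n \<omega>\<close> converges, so \<open>bp_W_lim\<close> is its genuine
    limit there.\<close>
  have AE: "AE \<omega> in M. summable (\<lambda>n. real n powr \<alpha> * \<bar>bp_W \<xi> p X (Suc n) \<omega> - bp_W \<xi> p X n \<omega>\<bar>)"
    by (rule AE_weighted_increments_summable) fact+
  show ?thesis
  proof (intro conjI impI)
    show "AE \<omega> in M. (\<lambda>n. bp_W_lim \<xi> p X \<omega> - bp_W \<xi> p X n \<omega>) \<in> o(\<lambda>n. real n powr (- \<alpha>))"
      using AE unfolding bp_W_lim_def
      by eventually_elim (rule tails_smallo_if_weighted_increments_summable[OF \<open>0 < \<alpha>\<close>])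
    assume "1 \<le> \<alpha>"
    show "AE \<omega> in M. summable (\<lambda>n. bp_W_lim \<xi> p X \<omega> - bp_W \<xi> p X n \<omega>)"
      using AE unfolding bp_W_lim_def
      by eventually_elim (rule tails_summable_if_weighted_increments_summable[OF \<open>0 < \<alpha>\<close> _ \<open>1 \<le> \<alpha>\<close>])
  qed
qed

end
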